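(* Signed Max Cut ATLB restricted to instances $(G,k)$ in which $G$ is a split graph admits a kernel with $O(k^2)$ vertices. That is, there is a polynomial-time algorithm and an absolute constant $c$ such that, given an instance $(G,k)$ of Signed Max Cut ATLB where $G$ is a split graph, the algorithm outputs an instance $(G',k')$ of Signed Max Cut ATLB with $|V(G')|\le c\,k^2$ such that $(G,k)$ is a Yes-instance if and only if $(G',k')$ is a Yes-instance.
   Context: A signed graph is a simple undirected graph in which each edge is labelled positive ($+$) or negative ($-$). A signed graph $G$ is balanced if there is a partition $(V_1,V_2)$ of $V(G)$ such that every edge with both endpoints in the same part is positive and every edge with endpoints in different parts is negative. For a signed graph $G$ with $n$ vertices and $m$ edges, Signed Max Cut ATLB is the problem: given a connected signed graph $G$ and a positive integer $k$ (the parameter), decide whether $G$ has a balanced subgraph (subgraph with vertex set $V(G)$ and a subset of the edges that is balanced) with at least $\frac{m}{2}+\frac{n-1}{4}+\frac{k}{4}$ edges; the instance is a Yes-instance if so. A split graph is a graph whose vertex set can be partitioned into a clique and an independent set. *)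

theory Defs
  imports
    "HOL-Library.Log_Nat"
    "HOL-Computational_Algebra.Polynomial"
begin

section \<open>Signed graphs\<close>

text \<open>Edges are two-element sets of vertices. The labelling is given by the sets of
  positive and of negative edges.\<close>

record 'a sgraph =
  verts :: "'a set"
  pos :: "'a set set"
  neg :: "'a set set"

definition edges :: "'a sgraph \<Rightarrow> 'a set set" where
  "edges G = pos G \<union> neg G"

definition signed_graph :: "'a sgraph \<Rightarrow> bool" where
  "signed_graph G \<longleftrightarrow>
     finite (verts G) \<and>
     (\<forall>e \<in> edges G. e \<subseteq> verts G \<and> card e = 2) \<and>
     pos G \<inter> neg G = {}"

definition connected_graph :: "'a sgraph \<Rightarrow> bool" where
  "connected_graph G \<longleftrightarrow>
     verts G \<noteq> {} \<and>
     (\<forall>u \<in> verts G. \<forall>v \<in> verts G. (u, v) \<in> {(x, y). {x, y} \<in> edges G}\<^sup>*)"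

text \<open>A part of the partition may be empty: a graph with only positive edges is balanced.\<close>

definition balanced :: "'a sgraph \<Rightarrow> bool" where
  "balanced G \<longleftrightarrow>
     (\<exists>V1 V2. V1 \<union> V2 = verts G \<and> V1 \<inter> V2 = {} \<and>
        (\<forall>e \<in> edges G. if e \<subseteq> V1 \<or> e \<subseteq> V2 then e \<in> pos G else e \<in> neg G))"

definition spanning_subgraph :: "'a sgraph \<Rightarrow> 'a sgraph \<Rightarrow> bool" where
  "spanning_subgraph H G \<longleftrightarrow> verts H = verts G \<and> pos H \<subseteq> pos G \<and> neg H \<subseteq> neg G"

definition split_graph :: "'a sgraph \<Rightarrow> bool" where
  "split_graph G \<longleftrightarrow>
     (\<exists>K I. K \<union> I = verts G \<and> K \<inter> I = {} \<and>
        (\<forall>u \<in> K. \<forall>v \<in> K. u \<noteq> v \<longrightarrow> {u, v} \<in> edges G) \<and>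
        (\<forall>u \<in> I. \<forall>v \<in> I. {u, v} \<notin> edges G))"

section \<open>Signed Max Cut ATLB\<close>

definition smc_instance :: "'a sgraph \<Rightarrow> nat \<Rightarrow> bool" where
  "smc_instance G k \<longleftrightarrow> signed_graph G \<and> connected_graph G \<and> k > 0"

definition smc_yes :: "'a sgraph \<Rightarrow> nat \<Rightarrow> bool" where
  "smc_yes G k \<longleftrightarrow>
     (\<exists>H. spanning_subgraph H G \<and> balanced H \<and>
        real (card (edges H)) \<ge>
          real (card (edges G)) / 2 + (real (card (verts G)) - 1) / 4 + real k / 4)"

section \<open>Random access machine programs\<close>

text \<open>Algorithms are while-programs for a random access machine over the natural numbers,
  with the unit-cost measure. Storage consists of finitely many named unbounded arrays (the
  names occurring in the program); a scalar variable is cell 0 of its array. Addresses can be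
  computed, and the only arithmetic is addition and truncated subtraction. As there is no
  multiplication, \<open>t\<close> steps of a fixed program lengthen the binary representation of the
  stored numbers by only \<open>O(t)\<close> bits, so that polynomial time on this machine is polynomial
  time on Turing machines. An assignment or a test evaluates expressions of a size fixed by
  the program and counts as one step.\<close>

type_synonym vname = string
type_synonym state = "vname \<Rightarrow> nat \<Rightarrow> nat"

datatype aexp = Const nat | Read vname aexp | Add aexp aexp | Sub aexp aexp

datatype bexp = Less aexp aexp | BNot bexp | BAnd bexp bexp

datatype com =
    Skip
  | Assign vname aexp aexp  \<comment> \<open>\<open>Assign x a e\<close> stands for \<open>x[a] := e\<close>\<close>
  | Seq com com
  | If bexp com com
  | While bexp com

fun aval :: "aexp \<Rightarrow> state \<Rightarrow> nat" where
  "aval (Const n) s = n"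
| "aval (Read x a) s = s x (aval a s)"
| "aval (Add a b) s = aval a s + aval b s"
| "aval (Sub a b) s = aval a s - aval b s"

fun bval :: "bexp \<Rightarrow> state \<Rightarrow> bool" where
  "bval (Less a b) s \<longleftrightarrow> aval a s < aval b s"
| "bval (BNot b) s \<longleftrightarrow> \<not> bval b s"
| "bval (BAnd b c) s \<longleftrightarrow> bval b s \<and> bval c s"

text \<open>\<open>exec p s t s'\<close>: started in state \<open>s\<close>, the program \<open>p\<close> halts after \<open>t\<close> steps in
  state \<open>s'\<close>.\<close>

inductive exec :: "com \<Rightarrow> state \<Rightarrow> nat \<Rightarrow> state \<Rightarrow> bool" where
  Skip: "exec Skip s 1 s"
| Assign: "exec (Assign x a e) s 1 (s(x := (s x)(aval a s := aval e s)))"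
| Seq: "exec p s t1 s1 \<Longrightarrow> exec q s1 t2 s2 \<Longrightarrow> exec (Seq p q) s (t1 + t2) s2"
| IfTrue: "bval b s \<Longrightarrow> exec p s t s1 \<Longrightarrow> exec (If b p q) s (1 + t) s1"
| IfFalse: "\<not> bval b s \<Longrightarrow> exec q s t s1 \<Longrightarrow> exec (If b p q) s (1 + t) s1"
| WhileFalse: "\<not> bval b s \<Longrightarrow> exec (While b p) s 1 s"
| WhileTrue: "bval b s \<Longrightarrow> exec p s t1 s1 \<Longrightarrow> exec (While b p) s1 t2 s2 \<Longrightarrow>
    exec (While b p) s (1 + t1 + t2) s2"

inductive_cases SkipE: "exec Skip s t s1"
inductive_cases AssignE: "exec (Assign x a e) s t s1"
inductive_cases SeqE: "exec (Seq p q) s t s1"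
inductive_cases IfE: "exec (If b p q) s t s1"
inductive_cases WhileE: "exec (While b p) s t s1"

lemma exec_deterministic:
  "exec p s t s1 \<Longrightarrow> exec p s t' s1' \<Longrightarrow> t = t' \<and> s1 = s1'"
proof (induction arbitrary: t' s1' rule: exec.induct)
  case (Skip s)
  then show ?case by (rule SkipE) simp
next
  case (Assign x a e s)
  then show ?case by (rule AssignE) simp
next
  case (Seq p s t1 s1 q t2 s2)
  from Seq.prems show ?case
    by (rule SeqE) (metis Seq.IH)
next
  case (IfTrue b s p t s1 q)
  from IfTrue.prems show ?case
    by (rule IfE) (metis IfTrue.IH plus_1_eq_Suc, metis IfTrue.hyps(1))
next
  case (IfFalse b s q t s1 p)
  from IfFalse.prems show ?case
    by (rule IfE) (metis IfFalse.hyps(1), metis IfFalse.IH plus_1_eq_Suc)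
next
  case (WhileFalse b s p)
  from WhileFalse.prems show ?case
    by (rule WhileE) (simp, metis WhileFalse.hyps)
next
  case (WhileTrue b s p t1 s1 t2 s2)
  from WhileTrue.prems show ?case
    by (rule WhileE) (metis WhileTrue.hyps(1), metis WhileTrue.IH add_Suc plus_1_eq_Suc)
qed

section \<open>Instances as input and output of programs\<close>

text \<open>A machine handles graphs with vertex set \<open>{..<n}\<close>, stored as the adjacency matrix in
  row-major order.\<close>

definition adj_entry :: "nat sgraph \<Rightarrow> nat \<Rightarrow> nat \<Rightarrow> nat" where
  "adj_entry G u v = (if {u, v} \<in> pos G then 1 else if {u, v} \<in> neg G then 2 else 0)"

definition represents :: "state \<Rightarrow> nat sgraph \<Rightarrow> nat \<Rightarrow> bool" where
  "represents s G k \<longleftrightarrow>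
     verts G = {..<s ''n'' 0} \<and> s ''k'' 0 = k \<and>
     (\<forall>u \<in> verts G. \<forall>v \<in> verts G. s ''A'' (u * s ''n'' 0 + v) = adj_entry G u v)"

definition input_state :: "nat sgraph \<Rightarrow> nat \<Rightarrow> state" where
  "input_state G k = (let n = card (verts G) in (\<lambda>x i.
     if x = ''n'' \<and> i = 0 then n
     else if x = ''k'' \<and> i = 0 then k
     else if x = ''A'' \<and> i < n * n then adj_entry G (i div n) (i mod n)
     else 0))"

lemma represents_input_state:
  assumes "verts G = {..<n}"
  shows "represents (input_state G k) G k"
proof -
  have "u * n + v < n * n" if "u < n" "v < n" for u v
  proof -
    have "Suc u * n \<le> n * n" using that by (intro mult_le_mono1) simp
    then show ?thesis using that by simp
  qed
  then show ?thesis
    using assms by (auto simp: represents_def input_state_def)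
qed

text \<open>The length of an instance: the entries of the matrix plus the binary digits of \<open>k\<close>.\<close>

definition instance_size :: "nat sgraph \<Rightarrow> nat \<Rightarrow> nat" where
  "instance_size G k = (card (verts G))\<^sup>2 + floorlog 2 k"

end

(*
  Writing b for the signed adjacency matrix with diagonal entries -1, an instance is a Yes-instance
  iff some sign vector x has value x^T b x at least k - 1. The best value of x on a vertex set is
  superadditive over disjoint sets, at least -1 on cliques and -1 on single vertices.

  Let K be the clique and I the independent set of a No-instance. An inclusion-minimal set in K
  dominating I yields stars and private leaves, hence |I| <= 3k - 2. A largest S in K of value at
  least |S| contains a vertex of every balanced triangle in K, hence |S| = O(k) and C = K - S is
  all-negative up to switching. For every vertex v outside C, a largest T in C such that T together
  with v has value at least |T| - 1 has O(k) elements, and v sees all of C - T in the same way.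
  Thus all but O(k^2) vertices have the same row of b up to sign. Of such a class of twins only the
  parity of its size matters once it is at least as large as its complement, so it can be shrunk.
  The program needs no split partition: it compares all rows of b, shrinks a sufficiently large
  twin class, and answers Yes if there is none.
*)

theory Submission
  imports Defs
begin

section \<open>Superadditivity of the excess over the Poljak-Turzik bound\<close>

text \<open>For a sign vector \<open>x\<close>, the off-diagonal part of x^T b x counts every edge
  twice, with +1 if the bipartition given by \<open>x\<close> satisfies it and with -1 otherwise. It
  equals 4 h - 2 m when h edges are satisfied, and the diagonal subtracts n. So the threshold m/2 +
  (n-1)/4 + k/4 on h becomes k - 1. The diagonal has a second use: in an all-negative clique the
  rows agree even in the columns of the clique, so the form is minus a square there and twins are
  found by comparing complete rows. The structural bounds share one pattern: a set of large value
  cannot exist in a No-instance, because what remains loses at most 1 on the clique and 1 per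
  independent vertex. The constant 35 is 7 + 7 * 4: at most 7k vertices lie in S or I, and each of
  them has at most 4k deviating vertices in C. Two obstacles shape the rest. The output must be
  connected again, so deleted twins need a substitute. The machine cannot multiply, and k may be
  exponential in the input length, so no loop may run up to k; the program uses 35 k min(n,k), which
  equals 35 k^2 unless k > n, and in that case the instance is left as it is.\<close>

definition qform :: "('a \<Rightarrow> 'a \<Rightarrow> int) \<Rightarrow> 'a set \<Rightarrow> ('a \<Rightarrow> int) \<Rightarrow> int" where
  "qform b S x = (\<Sum>u\<in>S. \<Sum>v\<in>S. b u v * x u * x v)"

definition sign_vector :: "('a \<Rightarrow> int) \<Rightarrow> bool" where
  "sign_vector x \<longleftrightarrow> (\<forall>u. x u = 1 \<or> x u = -1)"

text \<open>A lower-bound predicate in place of the maximum value: monotonicity and superadditivity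
  are all that is used, and no maximizer has to be named.\<close>

definition excess_ge :: "('a \<Rightarrow> 'a \<Rightarrow> int) \<Rightarrow> 'a set \<Rightarrow> int \<Rightarrow> bool" where
  "excess_ge b S m \<longleftrightarrow> (\<exists>x. sign_vector x \<and> m \<le> qform b S x)"

lemma sign_vectorD: "sign_vector x \<Longrightarrow> x u * x u = 1"
  unfolding sign_vector_def by (metis mult_1 mult_minus1 minus_minus)

lemma excess_ge_mono: "excess_ge b S m \<Longrightarrow> m' \<le> m \<Longrightarrow> excess_ge b S m'"
  unfolding excess_ge_def by (meson order_trans)

lemma qform_cong: "(\<And>u. u \<in> S \<Longrightarrow> x u = y u) \<Longrightarrow> qform b S x = qform b S y"
  unfolding qform_def by (intro sum.cong) auto

lemma qform_Un:
  assumes "finite S" "finite T" "S \<inter> T = {}" "\<And>u v. b u v = b v u"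
  shows "qform b (S \<union> T) x = qform b S x + qform b T x + 2 * (\<Sum>u\<in>S. \<Sum>v\<in>T. b u v * x u * x v)"
proof -
  have "(\<Sum>u\<in>T. \<Sum>v\<in>S. b u v * x u * x v) = (\<Sum>u\<in>S. \<Sum>v\<in>T. b u v * x u * x v)"
    by (subst sum.swap) (intro sum.cong refl, metis assms(4) mult.assoc mult.commute)
  then show ?thesis
    using assms(1-3) by (simp add: qform_def sum.union_disjoint sum.distrib)
qed

locale signed_matrix =
  fixes b :: "'a \<Rightarrow> 'a \<Rightarrow> int"
  assumes sym: "b u v = b v u"
    and diag: "b u u = -1"
    and range: "b u v \<in> {-1, 0, 1}"
begin

lemma qform_insert:
  assumes "finite S" "v \<notin> S" "sign_vector x"
  shows "qform b (insert v S) x = qform b S x - 1 + 2 * x v * (\<Sum>w\<in>S. b v w * x w)"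
proof -
  have "qform b ({v} \<union> S) x = qform b {v} x + qform b S x + 2 * (\<Sum>u\<in>{v}. \<Sum>w\<in>S. b u w * x u * x w)"
    using assms by (intro qform_Un sym) auto
  moreover have "qform b {v} x = -1"
    using diag sign_vectorD[OF assms(3)] by (simp add: qform_def)
  ultimately show ?thesis
    by (simp add: sum_distrib_left algebra_simps)
qed

text \<open>Negating the signs on all of \<open>T\<close> keeps the value on \<open>T\<close> and
  reverses the cross term, so the cross term can be made nonnegative.\<close>

lemma excess_ge_Un:
  assumes "finite S" "finite T" "S \<inter> T = {}" "excess_ge b S m" "excess_ge b T m'"
  shows "excess_ge b (S \<union> T) (m + m')"
proof -
  obtain x y where x: "sign_vector x" "m \<le> qform b S x" and y: "sign_vector y" "m' \<le> qform b T y"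
    using assms(4,5) by (auto simp: excess_ge_def)
  define c where "c = (\<Sum>u\<in>S. \<Sum>v\<in>T. b u v * x u * y v)"
  define e :: int where "e = (if c \<ge> 0 then 1 else -1)"
  define z where "z u = (if u \<in> S then x u else e * y u)" for u
  have "sign_vector z"
    using x(1) y(1) by (auto simp: sign_vector_def z_def e_def)
  have "qform b S z = qform b S x"
    by (rule qform_cong) (simp add: z_def)
  moreover have "qform b T z = qform b T y"
  proof -
    have "qform b T z = qform b T (\<lambda>u. e * y u)"
      using assms(3) by (intro qform_cong) (auto simp: z_def)
    also have "\<dots> = qform b T y"
      unfolding qform_def e_def by (intro sum.cong) auto
    finally show ?thesis .
  qed
  moreover have "(\<Sum>u\<in>S. \<Sum>v\<in>T. b u v * z u * z v) = e * c"
  proof -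
    have "(\<Sum>u\<in>S. \<Sum>v\<in>T. b u v * z u * z v) = (\<Sum>u\<in>S. \<Sum>v\<in>T. e * (b u v * x u * y v))"
      using assms(3) by (intro sum.cong refl) (auto simp: z_def)
    then show ?thesis by (simp add: c_def sum_distrib_left)
  qed
  moreover have "e * c \<ge> 0" by (simp add: e_def)
  ultimately have "m + m' \<le> qform b (S \<union> T) z"
    using qform_Un[OF assms(1-3), of b z] sym x(2) y(2) by simp
  then show ?thesis
    using \<open>sign_vector z\<close> by (auto simp: excess_ge_def)
qed

section \<open>Values of stars, cliques and triangles\<close>

lemma excess_ge_empty: "excess_ge b {} 0"
  unfolding excess_ge_def by (rule exI[of _ "\<lambda>_. 1"]) (simp add: sign_vector_def qform_def)

lemma excess_ge_singleton: "excess_ge b {v} (-1)"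
  unfolding excess_ge_def by (rule exI[of _ "\<lambda>_. 1"]) (simp add: sign_vector_def qform_def diag)

lemma excess_ge_card: "finite S \<Longrightarrow> excess_ge b S (- int (card S))"
proof (induction S rule: finite_induct)
  case empty
  then show ?case using excess_ge_empty by simp
next
  case (insert v S)
  then show ?case
    using excess_ge_Un[of "{v}" S, OF _ _ _ excess_ge_singleton insert.IH] by simp
qed

lemma excess_ge_Union:
  assumes "finite U" "\<And>u. u \<in> U \<Longrightarrow> finite (X u)"
    "\<And>u v. u \<in> U \<Longrightarrow> v \<in> U \<Longrightarrow> u \<noteq> v \<Longrightarrow> X u \<inter> X v = {}"
    "\<And>u. u \<in> U \<Longrightarrow> excess_ge b (X u) (f u)"
  shows "excess_ge b (\<Union>u\<in>U. X u) (\<Sum>u\<in>U. f u)"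
  using assms
proof (induction U rule: finite_induct)
  case empty
  then show ?case using excess_ge_empty by simp
next
  case (insert v U)
  have "excess_ge b (X v \<union> (\<Union>u\<in>U. X u)) (f v + (\<Sum>u\<in>U. f u))"
  proof (rule excess_ge_Un)
    show "X v \<inter> (\<Union>u\<in>U. X u) = {}"
      using insert.hyps(2) insert.prems(2)[of v] by fastforce
  qed (use insert in auto)
  then show ?case using insert.hyps by simp
qed

text \<open>The diagonal costs 1, and the only edge from \<open>v\<close> into \<open>S\<close>
  gains 2 once the sign of \<open>v\<close> is chosen to satisfy it.\<close>

lemma excess_ge_insert_leaf:
  assumes "finite S" "v \<notin> S" "w \<in> S" "b v w \<noteq> 0" "\<And>u. u \<in> S \<Longrightarrow> u \<noteq> w \<Longrightarrow> b v u = 0"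
    and "excess_ge b S m"
  shows "excess_ge b (insert v S) (m + 1)"
proof -
  obtain x where x: "sign_vector x" "m \<le> qform b S x"
    using assms(6) by (auto simp: excess_ge_def)
  define y where "y = x(v := b v w * x w)"
  have bvw: "b v w = 1 \<or> b v w = -1" using range[of v w] assms(4) by auto
  have y: "sign_vector y"
    using x(1) bvw by (auto simp: sign_vector_def y_def)
  have "qform b S y = qform b S x"
    using assms(2) by (intro qform_cong) (auto simp: y_def)
  moreover have "(\<Sum>u\<in>S. b v u * y u) = b v w * y w"
    using assms(1,3,5) by (subst sum.remove[of _ w]) auto
  moreover have "y v * (b v w * y w) = 1"
    using sign_vectorD[OF x(1), of w] assms(2,3) bvw by (auto simp: y_def)
  ultimately have "qform b (insert v S) y = qform b S x + 1"
    using qform_insert[OF assms(1,2) y] by (simp add: mult.assoc)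
  then show ?thesis
    using x(2) y by (auto simp: excess_ge_def)
qed

text \<open>Independence of \<open>P\<close> ensures that a leaf added earlier is not a second
  neighbour of a later one, so every leaf gains 1.\<close>

lemma excess_ge_add_leaves:
  assumes "finite P" "finite S" "S \<inter> P = {}" "excess_ge b S m"
    and "\<And>u v. u \<in> P \<Longrightarrow> v \<in> P \<Longrightarrow> u \<noteq> v \<Longrightarrow> b u v = 0"
    and "\<And>v. v \<in> P \<Longrightarrow> \<exists>w\<in>S. b v w \<noteq> 0 \<and> (\<forall>u\<in>S. u \<noteq> w \<longrightarrow> b v u = 0)"
  shows "excess_ge b (S \<union> P) (m + int (card P))"
  using assms
proof (induction P rule: finite_induct)
  case empty
  then show ?case by simp
next
  case (insert v P)
  have "excess_ge b (S \<union> P) (m + int (card P))"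
    using insert by (intro insert.IH) auto
  moreover obtain w where "w \<in> S" "b v w \<noteq> 0" "\<forall>u\<in>S. u \<noteq> w \<longrightarrow> b v u = 0"
    using insert.prems by blast
  ultimately have "excess_ge b (insert v (S \<union> P)) (m + int (card P) + 1)"
    using insert.hyps insert.prems by (intro excess_ge_insert_leaf[where w = w]) auto
  then show ?case
    using insert.hyps by (simp add: algebra_simps)
qed

lemma excess_ge_edge: "u \<noteq> v \<Longrightarrow> b u v \<noteq> 0 \<Longrightarrow> excess_ge b {u, v} 0"
  using excess_ge_insert_leaf[of "{v}" u v "-1"] excess_ge_singleton by simp

text \<open>A perfect matching splits the clique into edges of value 0.\<close>

lemma excess_ge_even_clique:
  assumes "finite K" "even (card K)" "\<And>u v. u \<in> K \<Longrightarrow> v \<in> K \<Longrightarrow> u \<noteq> v \<Longrightarrow> b u v \<noteq> 0"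
  shows "excess_ge b K 0"
  using assms
proof (induction "card K" arbitrary: K rule: less_induct)
  case less
  show ?case
  proof (cases "K = {}")
    case True
    then show ?thesis using excess_ge_empty by simp
  next
    case False
    then obtain u v where uv: "u \<in> K" "v \<in> K" "u \<noteq> v"
      using less.prems by (metis card_1_singleton_iff card_gt_0_iff is_singletonI' is_singleton_altdef odd_one)
    have "card K = Suc (Suc (card (K - {u, v})))"
      using uv less.prems(1) by (metis card_Suc_Diff1 finite_Diff Diff_insert2 insert_Diff insert_iff)
    then have "excess_ge b (K - {u, v}) 0"
      using less.prems by (intro less.hyps) auto
    then have "excess_ge b ({u, v} \<union> (K - {u, v})) (0 + 0)"
      using less.prems uv by (intro excess_ge_Un excess_ge_edge) auto
    moreover have "{u, v} \<union> (K - {u, v}) = K" using uv by auto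
    ultimately show ?thesis by simp
  qed
qed

lemma excess_ge_clique:
  assumes "finite K" "\<And>u v. u \<in> K \<Longrightarrow> v \<in> K \<Longrightarrow> u \<noteq> v \<Longrightarrow> b u v \<noteq> 0"
  shows "excess_ge b K (-1)"
proof (cases "even (card K)")
  case True
  then show ?thesis using excess_ge_even_clique[OF assms(1)] assms(2) excess_ge_mono by fastforce
next
  case False
  then obtain v where v: "v \<in> K" by fastforce
  have "even (card (K - {v}))" using False v assms(1) by simp
  then have "excess_ge b ({v} \<union> (K - {v})) (- 1 + 0)"
    using assms by (intro excess_ge_Un excess_ge_even_clique excess_ge_singleton) auto
  moreover have "{v} \<union> (K - {v}) = K" using v by auto
  ultimately show ?thesis by simp
qed

text \<open>Copying the signs of the row of \<open>u\<close> satisfies both edges at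
  \<open>u\<close>; the product condition says that the third edge is then satisfied as well. Three
  edges gain 6, three diagonal entries cost 3.\<close>

lemma excess_ge_triangle:
  assumes "u \<noteq> v" "v \<noteq> w" "u \<noteq> w" "b u v * b v w * b u w = 1"
  shows "excess_ge b {u, v, w} 3"
proof -
  define x where "x = (\<lambda>_. 1)(v := b u v, w := b u w)"
  have r: "b u v \<in> {-1, 1}" "b v w \<in> {-1, 1}" "b u w \<in> {-1, 1}"
    using range[of u v] range[of v w] range[of u w] assms(4) by auto
  then have x: "sign_vector x" by (auto simp: sign_vector_def x_def)
  have "qform b {u, v, w} x = 3"
    using qform_insert[of "{v, w}" u x] qform_insert[of "{w}" v x] qform_insert[of "{}" w x] x r assms
    by (auto simp: x_def qform_def)
  then show ?thesis using x by (auto simp: excess_ge_def)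
qed

text \<open>After switching by \<open>\<tau>\<close> the set \<open>C\<close> is all-negative. If
  \<open>u\<close> and \<open>w\<close> receive opposite switched signs, their contributions against
  \<open>T\<close> cancel and the edge between them pays for both diagonal entries. As
  \<open>v\<close> sees the two differently, one choice of the signs gains at least 2 from
  \<open>v\<close>.\<close>

lemma excess_ge_insert_pair:
  assumes "finite T" "v \<notin> C" "T \<subseteq> C" "u \<in> C - T" "w \<in> C - T"
    and tau: "\<And>y. y \<in> C \<Longrightarrow> \<tau> y = 1 \<or> \<tau> y = -1"
    and C: "\<And>y z. y \<in> C \<Longrightarrow> z \<in> C \<Longrightarrow> b y z = - \<tau> y * \<tau> z"
    and ne: "\<tau> u * b v u \<noteq> \<tau> w * b v w"
    and "excess_ge b (insert v T) m"
  shows "excess_ge b (insert v (insert u (insert w T))) (m + 2)"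
proof -
  obtain x where x: "sign_vector x" "m \<le> qform b (insert v T) x"
    using assms(9) by (auto simp: excess_ge_def)
  define d where "d = \<tau> u * b v u - \<tau> w * b v w"
  \<comment> \<open>The factor \<open>sgn d * x v\<close> turns the contribution of \<open>v\<close>
    to the new pair into the absolute value of \<open>d\<close>.\<close>
  define e where "e = sgn d * x v"
  define y where "y = x(u := \<tau> u * e, w := - \<tau> w * e)"
  have uw: "u \<noteq> w" "u \<noteq> v" "w \<noteq> v" "v \<notin> T" using ne assms(2-5) by auto
  have tu: "\<tau> u = 1 \<or> \<tau> u = -1" and tw: "\<tau> w = 1 \<or> \<tau> w = -1" using tau assms(4,5) by auto
  have "d \<noteq> 0" using ne by (simp add: d_def)
  then have e: "e = 1 \<or> e = -1"
    using x(1) by (auto simp: e_def sign_vector_def sgn_if)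
  have y: "sign_vector y"
    using x(1) tu tw e by (auto simp: y_def sign_vector_def)
  have cross: "(\<Sum>z\<in>T. b w z * y z) * y w + (\<Sum>z\<in>T. b u z * y z) * y u = 0"
  proof -
    have "b w z * y z * y w + b u z * y z * y u = 0" if "z \<in> T" for z
      using that C[of w z] C[of u z] assms(3-5) tu tw uw by (auto simp: y_def)
    then show ?thesis
      by (simp add: sum_distrib_right flip: sum.distrib)
  qed
  have "qform b (insert v T) y = qform b (insert v T) x"
    using uw assms(4,5) by (intro qform_cong) (auto simp: y_def)
  moreover have "insert v (insert u (insert w T)) = insert u (insert w (insert v T))" by auto
  moreover have "qform b (insert u (insert w (insert v T))) y = qform b (insert w (insert v T)) y - 1
      + 2 * y u * (b u w * y w + (b u v * y v + (\<Sum>z\<in>T. b u z * y z)))"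
    using assms(1,4,5) uw by (subst qform_insert[OF _ _ y]) auto
  moreover have "qform b (insert w (insert v T)) y = qform b (insert v T) y - 1
      + 2 * y w * (b w v * y v + (\<Sum>z\<in>T. b w z * y z))"
    using assms(1,4,5) uw by (subst qform_insert[OF _ _ y]) auto
  moreover have "y u * (b u w * y w) = 1"
    using C[of u w] assms(4,5) tu tw e uw by (auto simp: y_def)
  moreover have "y u * (b u v * y v) + y w * (b w v * y v) = \<bar>d\<bar>"
  proof -
    have "y u * (b u v * y v) + y w * (b w v * y v) = e * x v * d"
      using uw sym[of u v] sym[of w v] by (simp add: y_def d_def algebra_simps)
    also have "\<dots> = \<bar>d\<bar>"
      using sign_vectorD[OF x(1), of v] by (simp add: e_def mult.assoc abs_sgn mult.commute)
    finally show ?thesis .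
  qed
  moreover have "\<bar>d\<bar> \<ge> 1" using \<open>d \<noteq> 0\<close> by auto
  ultimately have "m + 2 \<le> qform b (insert v (insert u (insert w T))) y"
    using cross x(2) by (simp add: algebra_simps)
  then show ?thesis using y by (auto simp: excess_ge_def)
qed

end

section \<open>Twin classes in split graphs\<close>

context signed_matrix begin

text \<open>For a smallest dominating set \<open>U\<close>, the stars give |I| - |U| \<le> k - 1,
  and the private neighbours give 2|U| - |I| \<le> k. Twice the first inequality plus the second
  eliminates |U|.\<close>

lemma independent_set_bound:
  assumes fin: "finite K" "finite I" and disj: "K \<inter> I = {}"
    and K: "\<And>u v. u \<in> K \<Longrightarrow> v \<in> K \<Longrightarrow> u \<noteq> v \<Longrightarrow> b u v \<noteq> 0"
    and I: "\<And>u v. u \<in> I \<Longrightarrow> v \<in> I \<Longrightarrow> u \<noteq> v \<Longrightarrow> b u v = 0"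
    and nbr: "\<And>v. v \<in> I \<Longrightarrow> \<exists>u\<in>K. b v u \<noteq> 0"
    and no: "\<not> excess_ge b (K \<union> I) (k - 1)"
  shows "int (card I) \<le> 3 * k - 2"
proof -
  define dom where "dom U \<longleftrightarrow> U \<subseteq> K \<and> (\<forall>v\<in>I. \<exists>u\<in>U. b v u \<noteq> 0)" for U
  have "dom K" using nbr by (auto simp: dom_def)
  then obtain U where U: "dom U" and min: "\<And>W. dom W \<Longrightarrow> card U \<le> card W"
    using arg_min_nat_lemma[of dom K card] by blast
  have UK: "U \<subseteq> K" and finU: "finite U" using U fin finite_subset by (auto simp: dom_def)
  have cU: "excess_ge b (K - U) (-1)"
    using fin K by (intro excess_ge_clique) auto
  have "excess_ge b (U \<union> I) (int (card I) - int (card U))"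
  proof -
    \<comment> \<open>Each independent vertex joins the star of one chosen neighbour. Its other
      edges into \<open>U\<close> run between disjoint stars, where superadditivity takes care of
      them.\<close>
    obtain h where h: "\<And>v. v \<in> I \<Longrightarrow> h v \<in> U \<and> b v (h v) \<noteq> 0"
      using U unfolding dom_def by metis
    define X where "X u = {v\<in>I. h v = u}" for u
    have "excess_ge b (\<Union>u\<in>U. {u} \<union> X u) (\<Sum>u\<in>U. - 1 + int (card (X u)))"
    proof (rule excess_ge_Union[OF finU])
      show "excess_ge b ({u} \<union> X u) (- 1 + int (card (X u)))" if "u \<in> U" for u
      proof (rule excess_ge_add_leaves)
        show "\<exists>w\<in>{u}. b v w \<noteq> 0 \<and> (\<forall>u\<in>{u}. u \<noteq> w \<longrightarrow> b v u = 0)" if "v \<in> X u" for v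
          using h that by (auto simp: X_def)
      qed (use fin disj UK that I excess_ge_singleton in \<open>auto simp: X_def\<close>)
    qed (use fin disj UK in \<open>auto simp: X_def\<close>)
    moreover have "(\<Union>u\<in>U. {u} \<union> X u) = U \<union> I"
      using h by (auto simp: X_def)
    moreover have "(\<Sum>u\<in>U. card (X u)) = card I"
    proof -
      have "I = (\<Union>u\<in>U. X u)" using h by (auto simp: X_def)
      moreover have "card (\<Union>u\<in>U. X u) = (\<Sum>u\<in>U. card (X u))"
        using finU fin by (intro card_UN_disjoint) (auto simp: X_def)
      ultimately show ?thesis by simp
    qed
    ultimately show ?thesis
      by (simp add: sum.distrib sum_subtractf flip: of_nat_sum)
  qed
  from excess_ge_Un[OF _ _ _ this cU]
  have "excess_ge b (U \<union> I \<union> (K - U)) (int (card I) - int (card U) - 1)"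
    using fin finU disj by auto
  moreover have "U \<union> I \<union> (K - U) = K \<union> I" using UK by auto
  ultimately have A: "int (card I) - int (card U) - 1 < k - 1"
    using no excess_ge_mono by (metis not_less)
  \<comment> \<open>If every neighbour of \<open>u\<close> in \<open>I\<close> had another neighbour
    in \<open>U\<close>, then \<open>U - {u}\<close> would still dominate and be smaller.\<close>
  have "\<exists>v. v \<in> I \<and> b v u \<noteq> 0 \<and> (\<forall>w\<in>U. w \<noteq> u \<longrightarrow> b v w = 0)" if "u \<in> U" for u
  proof (rule ccontr)
    assume "\<not> ?thesis"
    then have "dom (U - {u})"
      using U unfolding dom_def by (metis Diff_iff Diff_subset singletonD subset_trans)
    from min[OF this] show False
      using that finU by (metis card_Diff1_less not_le)
  qed
  then obtain g where g: "\<And>u. u \<in> U \<Longrightarrow> g u \<in> I \<and> b (g u) u \<noteq> 0 \<and> (\<forall>w\<in>U. w \<noteq> u \<longrightarrow> b (g u) w = 0)"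
    by metis
  have "inj_on g U" by (rule inj_onI) (metis g)
  then have cg: "card (g ` U) = card U" by (rule card_image)
  have gI: "g ` U \<subseteq> I" using g by auto
  have "excess_ge b (U \<union> g ` U) (- 1 + int (card (g ` U)))"
  proof (rule excess_ge_add_leaves)
    show "excess_ge b U (-1)" using UK K finU by (intro excess_ge_clique) auto
    show "\<exists>w\<in>U. b v w \<noteq> 0 \<and> (\<forall>u\<in>U. u \<noteq> w \<longrightarrow> b v u = 0)" if "v \<in> g ` U" for v
      using that g by blast
    show "b v w = 0" if "v \<in> g ` U" "w \<in> g ` U" "v \<noteq> w" for v w
      using that gI I by blast
  qed (use finU UK gI disj in auto)
  then have "excess_ge b (U \<union> g ` U \<union> (K - U)) (- 1 + int (card (g ` U)) + - 1)"
    using fin finU disj UK gI by (intro excess_ge_Un[OF _ _ _ _ cU]) auto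
  then have "excess_ge b (U \<union> g ` U \<union> (K - U) \<union> (I - g ` U))
      (- 1 + int (card (g ` U)) + - 1 + - int (card (I - g ` U)))"
    using fin finU disj UK gI by (intro excess_ge_Un[OF _ _ _ _ excess_ge_card]) auto
  moreover have "int (card (I - g ` U)) = int (card I) - int (card U)"
    using fin finU gI cg by (simp add: card_Diff_subset of_nat_diff card_mono flip: cg)
  ultimately
  have "excess_ge b (U \<union> g ` U \<union> (K - U) \<union> (I - g ` U)) (2 * int (card U) - int (card I) - 2)"
    using cg by (simp add: algebra_simps)
  moreover have "U \<union> g ` U \<union> (K - U) \<union> (I - g ` U) = K \<union> I" using UK gI by auto
  ultimately have "2 * int (card U) - int (card I) - 2 < k - 1"
    using no excess_ge_mono by (metis not_less)
  with A show ?thesis by simp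
qed

text \<open>A triangle outside \<open>S\<close> with sign product 1 has value 3 and could be added
  to \<open>S\<close>. By maximality no such triangle exists, so the row of any fixed
  \<open>c\<close> outside \<open>S\<close> serves as the switching function.\<close>

lemma unbalanced_part_of_clique:
  assumes fin: "finite K" and K: "\<And>u v. u \<in> K \<Longrightarrow> v \<in> K \<Longrightarrow> u \<noteq> v \<Longrightarrow> b u v \<noteq> 0"
  obtains S \<tau> where "S \<subseteq> K" "excess_ge b S (int (card S))"
    "\<And>u. u \<in> K - S \<Longrightarrow> \<tau> u = 1 \<or> \<tau> u = -1"
    "\<And>u v. u \<in> K - S \<Longrightarrow> v \<in> K - S \<Longrightarrow> b u v = - \<tau> u * \<tau> v"
proof -
  define P where "P S \<longleftrightarrow> S \<subseteq> K \<and> excess_ge b S (int (card S))" for S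
  have "P {}" using excess_ge_empty by (simp add: P_def)
  moreover have "\<forall>S. P S \<longrightarrow> card S < Suc (card K)"
    using fin by (auto simp: P_def card_mono less_Suc_eq_le)
  ultimately obtain S where S: "P S" and max: "\<And>T. P T \<Longrightarrow> card T \<le> card S"
    using ex_has_greatest_nat[of P "{}" card] by blast
  have finS: "finite S" using S fin finite_subset by (auto simp: P_def)
  \<comment> \<open>If \<open>S\<close> is all of \<open>K\<close>, then \<open>c\<close> is
    arbitrary and the claims about \<open>K - S\<close> are vacuous.\<close>
  define c where "c = (SOME c. c \<in> K - S)"
  have r: "b u v = 1 \<or> b u v = -1" if "u \<in> K" "v \<in> K" for u v
    using range[of u v] diag K[OF that] by (cases "u = v") auto
  have "b u v = - b c u * b c v" if uv: "u \<in> K - S" "v \<in> K - S" for u v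
  proof -
    have c: "c \<in> K - S" using uv unfolding c_def by (metis someI)
    show ?thesis
    proof (cases "u = v \<or> u = c \<or> v = c")
      \<comment> \<open>The diagonal entry -1 makes the formula hold in the degenerate cases too; in
        particular \<open>c\<close> itself gets the switching sign -1.\<close>
      case True
      then show ?thesis
        using r[of u v] r[of c u] r[of c v] diag sym[of u c] c uv by auto
    next
      case False
      have "b c u * b u v * b c v \<noteq> 1"
      proof
        assume "b c u * b u v * b c v = 1"
        then have "excess_ge b {c, u, v} 3"
          using False by (intro excess_ge_triangle) auto
        then have "excess_ge b (S \<union> {c, u, v}) (int (card S) + 3)"
          using finS S c uv by (intro excess_ge_Un) (auto simp: P_def)
        moreover have "card (S \<union> {c, u, v}) = card S + 3"
          using finS c uv False by (subst card_Un_disjoint) auto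
        ultimately have "P (S \<union> {c, u, v})"
          using S c uv by (auto simp: P_def)
        from max[OF this] \<open>card (S \<union> {c, u, v}) = card S + 3\<close> show False by simp
      qed
      then show ?thesis
        using r[of u v] r[of c u] r[of c v] c uv by auto
    qed
  qed
  moreover have "b c u = 1 \<or> b c u = -1" if "u \<in> K - S" for u
  proof -
    have "c \<in> K - S" using that unfolding c_def by (metis someI)
    then show ?thesis using r that by auto
  qed
  ultimately show thesis
    using S by (intro that[of S "b c"]) (auto simp: P_def)
qed

text \<open>The empty set qualifies, since \<open>v\<close> alone has value -1. Two vertices outside
  a largest \<open>T\<close> that \<open>v\<close> sees differently after switching could be added,
  raising value and cardinality by 2 each.\<close>

lemma deviating_part:
  assumes fin: "finite C" and v: "v \<notin> C"
    and tau: "\<And>y. y \<in> C \<Longrightarrow> \<tau> y = 1 \<or> \<tau> y = -1"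
    and C: "\<And>y z. y \<in> C \<Longrightarrow> z \<in> C \<Longrightarrow> b y z = - \<tau> y * \<tau> z"
  obtains T where "T \<subseteq> C" "excess_ge b (insert v T) (int (card T) - 1)"
    "\<And>u w. u \<in> C - T \<Longrightarrow> w \<in> C - T \<Longrightarrow> \<tau> u * b v u = \<tau> w * b v w"
proof -
  define P where "P T \<longleftrightarrow> T \<subseteq> C \<and> excess_ge b (insert v T) (int (card T) - 1)" for T
  have "P {}" using excess_ge_singleton by (simp add: P_def)
  moreover have "\<forall>T. P T \<longrightarrow> card T < Suc (card C)"
    using fin by (auto simp: P_def card_mono less_Suc_eq_le)
  ultimately obtain T where T: "P T" and max: "\<And>U. P U \<Longrightarrow> card U \<le> card T"
    using ex_has_greatest_nat[of P "{}" card] by blast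
  have finT: "finite T" using T fin finite_subset by (auto simp: P_def)
  have "\<tau> u * b v u = \<tau> w * b v w" if uw: "u \<in> C - T" "w \<in> C - T" for u w
  proof (rule ccontr)
    assume ne: "\<tau> u * b v u \<noteq> \<tau> w * b v w"
    have "excess_ge b (insert v (insert u (insert w T))) (int (card T) - 1 + 2)"
      using finT v T uw ne by (intro excess_ge_insert_pair[where C = C and \<tau> = \<tau>] tau C) (auto simp: P_def)
    moreover have "card (insert u (insert w T)) = card T + 2"
      using ne uw finT by (subst card_insert_disjoint) auto
    ultimately have "P (insert u (insert w T))"
      using T uw by (auto simp: P_def)
    from max[OF this] \<open>card (insert u (insert w T)) = card T + 2\<close> show False by simp
  qed
  then show thesis using T unfolding P_def by (intro that[of T]) blast+
qed

text \<open>For \<open>c\<close> and \<open>u\<close> in \<open>V\<close> the compared columns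
  include those of \<open>c\<close> and \<open>u\<close>. In column \<open>c\<close> the diagonal
  entry is nonzero, so distinct twins are adjacent and a class is a clique.\<close>

definition twin :: "'a set \<Rightarrow> 'a \<Rightarrow> 'a \<Rightarrow> bool" where
  "twin V c u \<longleftrightarrow> (\<forall>w\<in>V. b u w = b c w) \<or> (\<forall>w\<in>V. b u w = - b c w)"

text \<open>Outside the exceptional set \<open>Y\<close>, all rows agree up to sign on
  \<open>R\<close> by the choice of the deviating parts, and on \<open>K - S\<close> because that
  part is all-negative after switching.\<close>

theorem large_twin_class:
  assumes fin: "finite K" "finite I" and disj: "K \<inter> I = {}"
    and K: "\<And>u v. u \<in> K \<Longrightarrow> v \<in> K \<Longrightarrow> u \<noteq> v \<Longrightarrow> b u v \<noteq> 0"
    and I: "\<And>u v. u \<in> I \<Longrightarrow> v \<in> I \<Longrightarrow> u \<noteq> v \<Longrightarrow> b u v = 0"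
    and nbr: "\<And>v. v \<in> I \<Longrightarrow> \<exists>u\<in>K. b v u \<noteq> 0"
    and no: "\<not> excess_ge b (K \<union> I) (int k - 1)"
    and large: "35 * k\<^sup>2 < card (K \<union> I)"
  obtains c where "c \<in> K \<union> I" "card (K \<union> I) \<le> card {u \<in> K \<union> I. twin (K \<union> I) c u} + 35 * k\<^sup>2"
proof -
  define V where "V = K \<union> I"
  have finV: "finite V" using fin by (simp add: V_def)
  have i: "int (card I) \<le> 3 * int k - 2"
    by (rule independent_set_bound[OF fin disj K I nbr no])
  obtain S \<tau> where S: "S \<subseteq> K" "excess_ge b S (int (card S))"
    and tau: "\<And>u. u \<in> K - S \<Longrightarrow> \<tau> u = 1 \<or> \<tau> u = -1"
    and C: "\<And>u v. u \<in> K - S \<Longrightarrow> v \<in> K - S \<Longrightarrow> b u v = - \<tau> u * \<tau> v"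
    using unbalanced_part_of_clique[OF fin(1) K] by blast
  \<comment> \<open>Around \<open>W\<close>, the rest of the clique costs at most 1 and the rest of
    \<open>I\<close> at most its size. This bounds the maximal sets \<open>S\<close> and
    \<open>insert v (T v)\<close> alike.\<close>
  have rest: "m \<le> int (card I) + int k"
    if W: "W \<subseteq> V" "excess_ge b W (m - 1)" for W m
  proof -
    have "excess_ge b (W \<union> (K - W) \<union> (I - W)) (m - 1 + - 1 + - int (card (I - W)))"
      using W finV fin disj K
      by (intro excess_ge_Un excess_ge_clique excess_ge_card) (auto simp: V_def finite_subset)
    moreover have "W \<union> (K - W) \<union> (I - W) = K \<union> I" using W by (auto simp: V_def)
    ultimately have "m - 1 + - 1 + - int (card (I - W)) < int k - 1"
      using no excess_ge_mono by (metis not_less)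
    moreover have "card (I - W) \<le> card I" using fin by (intro card_mono) auto
    ultimately show ?thesis by linarith
  qed
  define R where "R = S \<union> I"
  have R: "card R \<le> 7 * k" "finite R"
  proof -
    have "int (card S) \<le> int (card I) + int k"
      using S by (intro rest[of S]) (auto simp: V_def intro: excess_ge_mono)
    moreover have "card R \<le> card S + card I" unfolding R_def by (rule card_Un_le)
    ultimately show "card R \<le> 7 * k" using i by linarith
    show "finite R" using S fin finite_subset by (auto simp: R_def)
  qed
  have "\<exists>T. T \<subseteq> K - S \<and> card T \<le> 4 * k \<and>
      (\<forall>u \<in> K - S - T. \<forall>w \<in> K - S - T. \<tau> u * b v u = \<tau> w * b v w)" if v: "v \<in> R" for v
  proof -
    have "v \<notin> K - S" using v disj by (auto simp: R_def)
    then obtain T where T: "T \<subseteq> K - S" "excess_ge b (insert v T) (int (card T) - 1)"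
      "\<And>u w. u \<in> K - S - T \<Longrightarrow> w \<in> K - S - T \<Longrightarrow> \<tau> u * b v u = \<tau> w * b v w"
      using deviating_part[of "K - S" v \<tau>] fin tau C by blast
    have "int (card T) \<le> int (card I) + int k"
      using T(1,2) v S(1) by (intro rest[of "insert v T"]) (auto simp: V_def R_def)
    then have "card T \<le> 4 * k" using i by linarith
    then show ?thesis using T(1,3) by blast
  qed
  then obtain T where T: "\<And>v. v \<in> R \<Longrightarrow> T v \<subseteq> K - S" "\<And>v. v \<in> R \<Longrightarrow> card (T v) \<le> 4 * k"
    "\<And>u v w. v \<in> R \<Longrightarrow> u \<in> K - S - T v \<Longrightarrow> w \<in> K - S - T v \<Longrightarrow> \<tau> u * b v u = \<tau> w * b v w"
    by metis
  define Y where "Y = R \<union> (\<Union>v\<in>R. T v)"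
  have "card Y \<le> card R + (\<Sum>v\<in>R. card (T v))"
    unfolding Y_def using R(2) by (intro order_trans[OF card_Un_le] add_mono card_UN_le) auto
  also have "\<dots> \<le> card R + card R * (4 * k)"
    using sum_bounded_above[of R "\<lambda>v. card (T v)" "4 * k"] T(2) by simp
  also have "\<dots> \<le> 7 * k + (7 * k) * (4 * k)" using R by (intro add_mono mult_mono) auto
  \<comment> \<open>The sum is 7k + 28k^2, and k \<le> k^2 for natural numbers.\<close>
  also have "\<dots> \<le> 35 * k\<^sup>2" by (cases k) (auto simp: power2_eq_square algebra_simps)
  finally have Y: "card Y \<le> 35 * k\<^sup>2" .
  have finY: "finite Y"
    using R T(1) fin finite_subset unfolding Y_def by (metis finite_Diff finite_UN finite_UnI)
  have YV: "Y \<subseteq> V" using T(1) S by (auto simp: Y_def R_def V_def)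
  have "card Y < card V" using Y large by (simp add: V_def)
  then obtain c where c: "c \<in> V - Y"
    using YV card_mono[OF finY] by (metis DiffI leD subsetI)
  have X: "V - Y \<subseteq> K - S" by (auto simp: V_def Y_def R_def)
  have "V - Y \<subseteq> {u \<in> V. twin V c u}"
  proof
    fix u assume u: "u \<in> V - Y"
    \<comment> \<open>The sign relating the two rows must not depend on the column; it is the
      product of the switching signs.\<close>
    have "b u w = \<tau> u * \<tau> c * b c w" if w: "w \<in> V" for w
    proof (cases "w \<in> R")
      case True
      have "u \<in> K - S - T w" "c \<in> K - S - T w" using u c X True by (auto simp: Y_def)
      then have "\<tau> u * b w u = \<tau> c * b w c" using T(3)[OF True] by blast
      moreover have "\<tau> u = 1 \<or> \<tau> u = -1" "\<tau> c = 1 \<or> \<tau> c = -1" using tau u c X by blast+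
      ultimately show ?thesis unfolding sym[of w] by auto
    next
      case False
      then have "w \<in> K - S" using w by (auto simp: V_def R_def)
      moreover have "u \<in> K - S" "c \<in> K - S" using u c X by auto
      ultimately show ?thesis using C[of u w] C[of c w] tau[of c] by auto
    qed
    moreover have "\<tau> u * \<tau> c = 1 \<or> \<tau> u * \<tau> c = -1"
      using tau[of u] tau[of c] subsetD[OF X u] subsetD[OF X c] by auto
    ultimately show "u \<in> {u \<in> V. twin V c u}" using u by (auto simp: twin_def)
  qed
  then have "card (V - Y) \<le> card {u \<in> V. twin V c u}"
    using finV by (intro card_mono) auto
  then have "card V \<le> card {u \<in> V. twin V c u} + 35 * k\<^sup>2"
    using Y YV finY by (simp add: card_Diff_subset)
  then show thesis using c by (intro that[of c]) (auto simp: V_def)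
qed

end

section \<open>Shrinking a twin class\<close>

text \<open>With j entries equal to 1 the sum is 2j - |X|, so every value in the range with the
  right parity occurs.\<close>

lemma sign_vector_with_sum:
  fixes s :: int
  assumes "finite X" "\<bar>s\<bar> \<le> int (card X)" "even (s + int (card X))"
  obtains y :: "'a \<Rightarrow> int" where "sign_vector y" "(\<Sum>u\<in>X. y u) = s"
proof -
  define j where "j = nat ((s + int (card X)) div 2)"
  have j: "2 * int j = s + int (card X)" using assms(2,3) by (simp add: j_def)
  then have "j \<le> card X" using assms(2) by linarith
  then obtain Y where Y: "Y \<subseteq> X" "card Y = j"
    by (meson obtain_subset_with_card_n)
  define y :: "'a \<Rightarrow> int" where "y u = (if u \<in> Y then 1 else -1)" for u
  have "(\<Sum>u\<in>X. y u) = (\<Sum>u\<in>Y. y u) + (\<Sum>u\<in>X - Y. y u)"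
    using Y(1) assms(1) by (metis sum.subset_diff add.commute)
  also have "\<dots> = int j - (int (card X) - int j)"
    using Y assms(1) \<open>j \<le> card X\<close> finite_subset[OF Y(1)]
    by (simp add: y_def card_Diff_subset of_nat_diff)
  also have "\<dots> = s" using j by simp
  finally show thesis by (intro that[of y]) (auto simp: sign_vector_def y_def)
qed

lemma sign_vector_sum_bound:
  assumes "finite X" "\<And>u. u \<in> X \<Longrightarrow> y u = 1 \<or> y u = (-1::int)"
  shows "\<bar>\<Sum>u\<in>X. y u\<bar> \<le> int (card X) \<and> even ((\<Sum>u\<in>X. y u) + int (card X))"
  using assms
proof (induction X rule: finite_induct)
  case (insert v X)
  have "\<bar>\<Sum>u\<in>X. y u\<bar> \<le> int (card X) \<and> even ((\<Sum>u\<in>X. y u) + int (card X))" "y v = 1 \<or> y v = -1"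
    using insert by auto
  then show ?case using insert.hyps by auto
qed simp

context signed_matrix begin

text \<open>With \<open>s = \<Sum>\<^sub>X \<tau> x\<close>, the vertices of a twin class \<open>X\<close> contribute \<open>2 s L - s\<^sup>2\<close>, where \<open>\<bar>L\<bar>\<close> is
  at most the number of vertices outside \<open>X\<close>. The optimal \<open>s\<close> is the value of the right parity
  closest to \<open>L\<close>, and it stays available as long as \<open>X\<close> is at least as large as its complement.\<close>

lemma excess_ge_shrink_twin_class:
  assumes finR: "finite R" and finX: "finite X" and disj: "R \<inter> X = {}"
    and X': "X' \<subseteq> X" "even (card X + card X')" "card R \<le> card X'"
    and c: "c \<in> X" and twins: "\<And>u. u \<in> X \<Longrightarrow> twin (R \<union> X) c u"
  shows "excess_ge b (R \<union> X) m \<longleftrightarrow> excess_ge b (R \<union> X') m"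
proof
  have finX': "finite X'" using X' finX finite_subset by blast
  have "\<exists>t. (t = 1 \<or> t = -1) \<and> (\<forall>w\<in>R \<union> X. b u w = t * b c w)" if "u \<in> X" for u
    using twins[OF that] unfolding twin_def
  proof
    assume "\<forall>w\<in>R \<union> X. b u w = b c w"
    then show ?thesis by (intro exI[of _ 1]) simp
  next
    assume "\<forall>w\<in>R \<union> X. b u w = - b c w"
    then show ?thesis by (intro exI[of _ "-1"]) simp
  qed
  then obtain \<tau> where tau: "\<And>u. u \<in> X \<Longrightarrow> \<tau> u = 1 \<or> \<tau> u = -1"
    and row: "\<And>u w. u \<in> X \<Longrightarrow> w \<in> R \<union> X \<Longrightarrow> b u w = \<tau> u * b c w"
    by metis
  \<comment> \<open>Evaluating the row of \<open>w\<close> at the column \<open>c\<close> gives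
    \<open>b w c = - \<tau> w\<close> because of the diagonal entry at \<open>c\<close>. Hence the
    block of the class has rank one, diagonal included.\<close>
  have clique: "b u w = - \<tau> u * \<tau> w" if "u \<in> X" "w \<in> X" for u w
    using row[of u w] row[of w c] that c sym[of c w] diag[of c] by simp
  have tau_ne: "\<tau> u \<noteq> 0" if "u \<in> X" for u using tau[OF that] by auto
  {
    assume "excess_ge b (R \<union> X') m"
    \<comment> \<open>The deleted vertices form a clique of even size, so putting them back loses
      nothing.\<close>
    moreover have "excess_ge b (X - X') 0"
    proof (rule excess_ge_even_clique)
      show "even (card (X - X'))"
        using X' finX finX' by (simp add: card_Diff_subset card_mono)
    qed (use finX clique tau_ne in auto)
    ultimately have "excess_ge b (R \<union> X' \<union> (X - X')) (m + 0)"
      using finR finX finX' X' disj by (intro excess_ge_Un) auto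
    moreover have "R \<union> X' \<union> (X - X') = R \<union> X" using X' by auto
    ultimately show "excess_ge b (R \<union> X) m" by simp
  }
  have expand: "qform b (R \<union> Z) x = qform b R x - (\<Sum>u\<in>Z. \<tau> u * x u)\<^sup>2
      + 2 * (\<Sum>u\<in>Z. \<tau> u * x u) * (\<Sum>w\<in>R. b c w * x w)" if Z: "Z \<subseteq> X" for Z x
  proof -
    have "finite Z" "Z \<inter> R = {}" using Z finX disj finite_subset by blast+
    from qform_Un[where b = b and x = x, OF this(1) finR this(2) sym]
    have "qform b (R \<union> Z) x = qform b R x + qform b Z x + 2 * (\<Sum>u\<in>Z. \<Sum>w\<in>R. b u w * x u * x w)"
      by (simp add: Un_commute)
    moreover have "qform b Z x = - (\<Sum>u\<in>Z. \<tau> u * x u)\<^sup>2"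
    proof -
      have "qform b Z x = (\<Sum>u\<in>Z. \<Sum>w\<in>Z. - ((\<tau> u * x u) * (\<tau> w * x w)))"
        unfolding qform_def using Z clique by (intro sum.cong refl) (auto simp: subset_iff)
      then show ?thesis by (simp add: sum_negf power2_eq_square sum_product)
    qed
    moreover have "(\<Sum>u\<in>Z. \<Sum>w\<in>R. b u w * x u * x w) = (\<Sum>u\<in>Z. \<tau> u * x u) * (\<Sum>w\<in>R. b c w * x w)"
    proof -
      have "(\<Sum>u\<in>Z. \<Sum>w\<in>R. b u w * x u * x w) = (\<Sum>u\<in>Z. \<Sum>w\<in>R. (\<tau> u * x u) * (b c w * x w))"
      proof (intro sum.cong refl)
        fix u w assume "u \<in> Z" "w \<in> R"
        then have "b u w = \<tau> u * b c w" using row[of u w] Z by auto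
        then show "b u w * x u * x w = (\<tau> u * x u) * (b c w * x w)" by (simp only: ac_simps)
      qed
      then show ?thesis by (simp add: sum_product)
    qed
    ultimately show ?thesis by simp
  qed
  {
    assume "excess_ge b (R \<union> X) m"
    then obtain x where x: "sign_vector x" "m \<le> qform b (R \<union> X) x"
      by (auto simp: excess_ge_def)
    define s where "s = (\<Sum>u\<in>X. \<tau> u * x u)"
    define L where "L = (\<Sum>w\<in>R. b c w * x w)"
    define t where "t = int (card X')"
    have "\<bar>s\<bar> \<le> int (card X) \<and> even (s + int (card X))"
      unfolding s_def
    proof (rule sign_vector_sum_bound[OF finX])
      show "\<tau> u * x u = 1 \<or> \<tau> u * x u = -1" if "u \<in> X" for u
        using tau[OF that] x(1) by (auto simp: sign_vector_def)
    qed
    then have s: "\<bar>s\<bar> \<le> int (card X)" "even (s + t)"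
      using X'(2) by (auto simp: t_def)
    have "\<bar>L\<bar> \<le> (\<Sum>w\<in>R. \<bar>b c w * x w\<bar>)" unfolding L_def by (rule sum_abs)
    also have "\<dots> \<le> (\<Sum>w\<in>R. 1)"
    proof (rule sum_mono)
      fix w show "\<bar>b c w * x w\<bar> \<le> 1"
        using range[of c w] spec[OF x(1)[unfolded sign_vector_def], of w] by (auto simp: abs_mult)
    qed
    finally have L: "\<bar>L\<bar> \<le> t" using X'(3) by (simp add: t_def)
    \<comment> \<open>The sum is clamped to the interval from \<open>- t\<close> to
      \<open>t\<close>. Both end points have the parity of \<open>s\<close>, and since
      \<open>L\<close> lies in the interval, clamping never moves away from
      \<open>L\<close>.\<close>
    define s' where "s' = (if \<bar>s\<bar> \<le> t then s else if s > 0 then t else - t)"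
    have "\<bar>s'\<bar> \<le> t" "even (s' + t)" using s(2) by (auto simp: s'_def t_def)
    then obtain y where y: "sign_vector y" "(\<Sum>u\<in>X'. y u) = s'"
      using sign_vector_with_sum[OF finX', of s'] by (auto simp: t_def)
    define z where "z u = (if u \<in> X' then \<tau> u * y u else x u)" for u
    have z: "sign_vector z"
      unfolding sign_vector_def
    proof
      fix u show "z u = 1 \<or> z u = -1"
        using tau[OF subsetD[OF X'(1)], of u] spec[OF x(1)[unfolded sign_vector_def], of u]
          spec[OF y(1)[unfolded sign_vector_def], of u] by (auto simp: z_def)
    qed
    have "R \<inter> X' = {}" using disj X' by auto
    then have zR: "z w = x w" if "w \<in> R" for w using that by (auto simp: z_def)
    have "(\<Sum>u\<in>X'. \<tau> u * z u) = (\<Sum>u\<in>X'. y u)"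
    proof (rule sum.cong[OF refl])
      fix u assume "u \<in> X'"
      then show "\<tau> u * z u = y u" using tau[OF subsetD[OF X'(1)], of u] by (auto simp: z_def)
    qed
    moreover have "qform b R z = qform b R x" using zR by (rule qform_cong)
    moreover have "(\<Sum>w\<in>R. b c w * z w) = L" using zR by (simp add: L_def)
    ultimately have "qform b (R \<union> X') z = qform b R x - s'\<^sup>2 + 2 * s' * L"
      using expand[OF X'(1), of z] y(2) by simp
    moreover have "qform b (R \<union> X) x = qform b R x - s\<^sup>2 + 2 * s * L"
      using expand[of X x] by (simp add: s_def L_def)
    \<comment> \<open>Completing the square: both sides are L^2 minus the squared distance from
      \<open>L\<close>.\<close>
    moreover have "- s\<^sup>2 + 2 * s * L \<le> - s'\<^sup>2 + 2 * s' * L"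
    proof -
      have "\<bar>s' - L\<bar> \<le> \<bar>s - L\<bar>" using L by (auto simp: s'_def)
      then have "(s' - L)\<^sup>2 \<le> (s - L)\<^sup>2" by (simp add: abs_le_square_iff)
      then show ?thesis by (simp add: power2_diff)
    qed
    ultimately show "excess_ge b (R \<union> X') m"
      using x(2) z by (auto simp: excess_ge_def intro!: exI[of _ z])
  }
qed

end

section \<open>Signed graphs and matrices\<close>

definition sgraph_matrix :: "'a sgraph \<Rightarrow> 'a \<Rightarrow> 'a \<Rightarrow> int" where
  "sgraph_matrix G u v =
     (if u = v then -1 else if {u, v} \<in> pos G then 1 else if {u, v} \<in> neg G then -1 else 0)"

lemma signed_matrix_sgraph_matrix: "signed_matrix (sgraph_matrix G)"
  by standard (auto simp: sgraph_matrix_def insert_commute)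

lemma edge_iff_sgraph_matrix:
  assumes "signed_graph G"
  shows "{u, v} \<in> edges G \<longleftrightarrow> u \<noteq> v \<and> sgraph_matrix G u v \<noteq> 0"
proof -
  have "{u, v} \<in> edges G \<Longrightarrow> u \<noteq> v"
    using assms by (auto simp: signed_graph_def)
  then show ?thesis by (auto simp: sgraph_matrix_def edges_def)
qed

text \<open>The edge set of the largest subgraph that is balanced with respect to the parts
  \<open>W\<close> and \<open>verts G - W\<close>, for \<open>W\<close> contained in
  \<open>verts G\<close>.\<close>

definition satisfied_edges :: "'a sgraph \<Rightarrow> 'a set \<Rightarrow> 'a set set" where
  "satisfied_edges G W =
     {e \<in> edges G. if e \<subseteq> W \<or> e \<subseteq> verts G - W then e \<in> pos G else e \<in> neg G}"

lemma finite_edges: "signed_graph G \<Longrightarrow> finite (edges G)"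
  unfolding signed_graph_def by (meson Pow_iff finite_Pow_iff finite_subset subsetI)

text \<open>The double sum splits into the diagonal and the ordered pairs that form edges; each edge
  has two orderings with the same contribution.\<close>

lemma qform_satisfied_edges:
  assumes G: "signed_graph G" and x: "\<And>u. u \<in> verts G \<Longrightarrow> x u = (if u \<in> W then 1 else -1)"
  shows "qform (sgraph_matrix G) (verts G) x =
    4 * int (card (satisfied_edges G W)) - 2 * int (card (edges G)) - int (card (verts G))"
proof -
  let ?V = "verts G" and ?b = "sgraph_matrix G"
  let ?S = "satisfied_edges G W"
  define f where "f e = (if e \<in> ?S then 1 else - 1 :: int)" for e
  define P where "P = {(u, v). u \<in> ?V \<and> v \<in> ?V \<and> {u, v} \<in> edges G}"
  have finV: "finite ?V" and disj: "pos G \<inter> neg G = {}"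
    and e2: "\<And>e. e \<in> edges G \<Longrightarrow> e \<subseteq> ?V \<and> card e = 2"
    using G by (auto simp: signed_graph_def)
  have "P \<subseteq> ?V \<times> ?V" by (auto simp: P_def)
  then have finP: "finite P" using finV finite_subset by blast
  have val: "?b u v * x u * x v = f {u, v}" if "(u, v) \<in> P" for u v
  proof -
    have uv: "u \<in> ?V" "v \<in> ?V" "{u, v} \<in> edges G" using that by (auto simp: P_def)
    moreover have "u \<noteq> v" using e2[OF uv(3)] by auto
    ultimately show ?thesis
      using disj x[of u] x[of v] by (auto simp: f_def satisfied_edges_def sgraph_matrix_def edges_def)
  qed
  have "qform ?b ?V x = (\<Sum>(u, v)\<in>?V \<times> ?V. ?b u v * x u * x v)"
    by (simp add: qform_def sum.cartesian_product)
  also have "\<dots> = (\<Sum>(u, v)\<in>(\<lambda>u. (u, u)) ` ?V \<union> P. ?b u v * x u * x v)"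
  proof (rule sum.mono_neutral_right)
    show "\<forall>p\<in>?V \<times> ?V - ((\<lambda>u. (u, u)) ` ?V \<union> P). (case p of (u, v) \<Rightarrow> ?b u v * x u * x v) = 0"
      using edge_iff_sgraph_matrix[OF G] by (auto simp: P_def)
  qed (use finV in \<open>auto simp: P_def\<close>)
  also have "\<dots> = (\<Sum>(u, v)\<in>(\<lambda>u. (u, u)) ` ?V. ?b u v * x u * x v) + (\<Sum>(u, v)\<in>P. ?b u v * x u * x v)"
  proof (rule sum.union_disjoint)
    show "finite P" by (rule finP)
    show "(\<lambda>u. (u, u)) ` ?V \<inter> P = {}" using edge_iff_sgraph_matrix[OF G] by (auto simp: P_def simp del: insert_absorb2)
  qed (use finV in auto)
  also have "(\<Sum>(u, v)\<in>(\<lambda>u. (u, u)) ` ?V. ?b u v * x u * x v) = (\<Sum>u\<in>?V. -1)"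
  proof -
    have "?b u u * x u * x u = -1" if "u \<in> ?V" for u
      using x[OF that] by (simp add: sgraph_matrix_def)
    then show ?thesis by (simp add: sum.reindex inj_on_def)
  qed
  also have "(\<Sum>(u, v)\<in>P. ?b u v * x u * x v) = (\<Sum>(u, v)\<in>P. f {u, v})"
    using val by (intro sum.cong) auto
  also have "\<dots> = (\<Sum>e\<in>edges G. \<Sum>p\<in>{p \<in> P. (case p of (u, v) \<Rightarrow> {u, v}) = e}. case p of (u, v) \<Rightarrow> f {u, v})"
    using finP finite_edges[OF G] by (intro sum.group[symmetric]) (auto simp: P_def)
  also have "\<dots> = (\<Sum>e\<in>edges G. 2 * f e)"
  proof (rule sum.cong[OF refl])
    fix e assume e: "e \<in> edges G"
    then obtain p q where pq: "e = {p, q}" "p \<noteq> q" using e2 by (meson card_2_iff)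
    have pqV: "p \<in> ?V" "q \<in> ?V" "{p, q} \<in> edges G" "{q, p} \<in> edges G"
      using e e2[OF e] pq(1) by (auto simp: insert_commute)
    have "{r \<in> P. (case r of (u, v) \<Rightarrow> {u, v}) = e} = {(p, q), (q, p)}"
    proof (rule set_eqI)
      fix r :: "'a \<times> 'a"
      obtain u v where r: "r = (u, v)" by (cases r)
      have "{u, v} = {p, q} \<longleftrightarrow> u = p \<and> v = q \<or> u = q \<and> v = p" by (rule doubleton_eq_iff)
      then show "r \<in> {r \<in> P. (case r of (u, v) \<Rightarrow> {u, v}) = e} \<longleftrightarrow> r \<in> {(p, q), (q, p)}"
        using pqV unfolding P_def pq(1) r by (simp, blast)
    qed
    moreover have "f {q, p} = f e" "f {p, q} = f e"
      by (simp_all add: pq(1) insert_commute)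
    ultimately show "(\<Sum>r\<in>{r \<in> P. (case r of (u, v) \<Rightarrow> {u, v}) = e}. case r of (u, v) \<Rightarrow> f {u, v}) = 2 * f e"
      using pq(2) by simp
  qed
  also have "\<dots> = 2 * (\<Sum>e\<in>edges G. f e)" by (simp add: sum_distrib_left)
  also have "(\<Sum>e\<in>edges G. f e) = (\<Sum>e\<in>edges G - ?S. f e) + (\<Sum>e\<in>?S. f e)"
    by (rule sum.subset_diff) (auto simp: satisfied_edges_def finite_edges G)
  also have "(\<Sum>e\<in>edges G - ?S. f e) = - int (card (edges G - ?S))" by (simp add: f_def)
  also have "int (card (edges G - ?S)) = int (card (edges G)) - int (card ?S)"
  proof -
    have "?S \<subseteq> edges G" by (auto simp: satisfied_edges_def)
    then show ?thesis using finite_edges[OF G]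
      by (simp add: card_Diff_subset finite_subset of_nat_diff card_mono)
  qed
  also have "(\<Sum>e\<in>?S. f e) = int (card ?S)" by (simp add: f_def)
  finally show ?thesis by simp
qed

text \<open>A balanced subgraph with parts \<open>V1\<close> and \<open>V2\<close> contains only
  edges satisfied by \<open>V1\<close>, and the satisfied edges themselves form a balanced subgraph.
  Multiplying by 4 replaces the real threshold by an integer one.\<close>

lemma smc_yes_iff_satisfied_edges:
  assumes G: "signed_graph G"
  shows "smc_yes G k \<longleftrightarrow> (\<exists>W\<subseteq>verts G.
    2 * int (card (edges G)) + int (card (verts G)) - 1 + int k \<le> 4 * int (card (satisfied_edges G W)))"
proof -
  have real: "real h \<ge> real m / 2 + (real n - 1) / 4 + real k / 4 \<longleftrightarrow>
      2 * int m + int n - 1 + int k \<le> 4 * int h" for h m n :: nat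
  proof -
    have "real h \<ge> real m / 2 + (real n - 1) / 4 + real k / 4 \<longleftrightarrow>
        real_of_int (2 * int m + int n - 1 + int k) \<le> real_of_int (4 * int h)"
      by (simp add: field_simps)
    then show ?thesis unfolding of_int_le_iff .
  qed
  show ?thesis
  proof
    assume "smc_yes G k"
    then obtain H where H: "spanning_subgraph H G" "balanced H"
      and le: "2 * int (card (edges G)) + int (card (verts G)) - 1 + int k \<le> 4 * int (card (edges H))"
      unfolding smc_yes_def real by blast
    then obtain V1 V2 where V12: "V1 \<union> V2 = verts G" "V1 \<inter> V2 = {}"
      "\<forall>e\<in>edges H. if e \<subseteq> V1 \<or> e \<subseteq> V2 then e \<in> pos H else e \<in> neg H"
      by (auto simp: balanced_def spanning_subgraph_def)
    have V2: "verts G - V1 = V2" using V12(1,2) by blast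
    have HG: "pos H \<subseteq> pos G" "neg H \<subseteq> neg G" using H(1) by (auto simp: spanning_subgraph_def)
    have "edges H \<subseteq> satisfied_edges G V1"
    proof
      fix e assume e: "e \<in> edges H"
      then have "e \<in> edges G" using HG by (auto simp: edges_def)
      moreover have "if e \<subseteq> V1 \<or> e \<subseteq> V2 then e \<in> pos G else e \<in> neg G"
        using bspec[OF V12(3) e] HG by (auto split: if_splits)
      ultimately show "e \<in> satisfied_edges G V1" by (simp add: satisfied_edges_def V2)
    qed
    then have "card (edges H) \<le> card (satisfied_edges G V1)"
      using finite_edges[OF G] by (intro card_mono) (auto simp: satisfied_edges_def)
    then show "\<exists>W\<subseteq>verts G. 2 * int (card (edges G)) + int (card (verts G)) - 1 + int k
        \<le> 4 * int (card (satisfied_edges G W))"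
      using le V12(1) by (intro exI[of _ V1]) auto
  next
    assume "\<exists>W\<subseteq>verts G. 2 * int (card (edges G)) + int (card (verts G)) - 1 + int k
        \<le> 4 * int (card (satisfied_edges G W))"
    then obtain W where W: "W \<subseteq> verts G"
      and le: "2 * int (card (edges G)) + int (card (verts G)) - 1 + int k \<le> 4 * int (card (satisfied_edges G W))"
      by blast
    let ?m = "\<lambda>e. e \<subseteq> W \<or> e \<subseteq> verts G - W"
    define H where "H = \<lparr>verts = verts G, pos = {e \<in> pos G. ?m e}, neg = {e \<in> neg G. \<not> ?m e}\<rparr>"
    have "edges H = satisfied_edges G W"
      by (auto simp: H_def edges_def satisfied_edges_def)
    moreover have "spanning_subgraph H G" by (auto simp: spanning_subgraph_def H_def)
    moreover have "balanced H"
      unfolding balanced_def using W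
      by (intro exI[of _ W] exI[of _ "verts G - W"]) (auto simp: H_def edges_def)
    ultimately show "smc_yes G k"
      using le unfolding smc_yes_def real by metis
  qed
qed

lemma smc_yes_iff_excess_ge:
  assumes G: "signed_graph G"
  shows "smc_yes G k \<longleftrightarrow> excess_ge (sgraph_matrix G) (verts G) (int k - 1)"
proof
  assume "smc_yes G k"
  then obtain W where
    "2 * int (card (edges G)) + int (card (verts G)) - 1 + int k \<le> 4 * int (card (satisfied_edges G W))"
    by (auto simp: smc_yes_iff_satisfied_edges[OF G])
  moreover define x where "x u = (if u \<in> W then 1 else -1 :: int)" for u
  moreover have "sign_vector x" by (simp add: x_def sign_vector_def)
  ultimately show "excess_ge (sgraph_matrix G) (verts G) (int k - 1)"
    using qform_satisfied_edges[OF G, of x W] by (auto simp: excess_ge_def intro!: exI[of _ x])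
next
  assume "excess_ge (sgraph_matrix G) (verts G) (int k - 1)"
  then obtain x where x: "sign_vector x" "int k - 1 \<le> qform (sgraph_matrix G) (verts G) x"
    by (auto simp: excess_ge_def)
  have "x u = (if u \<in> {u \<in> verts G. x u = 1} then 1 else -1)" if "u \<in> verts G" for u
    using x(1) that by (auto simp: sign_vector_def)
  from qform_satisfied_edges[OF G this] x(2) show "smc_yes G k"
    unfolding smc_yes_iff_satisfied_edges[OF G]
    by (intro exI[of _ "{u \<in> verts G. x u = 1}"]) auto
qed

section \<open>Renumbering vertices and reading graphs off matrices\<close>

lemma excess_ge_reindex:
  assumes L: "bij_betw L S T" and eq: "\<And>i j. i \<in> S \<Longrightarrow> j \<in> S \<Longrightarrow> b i j = b' (L i) (L j)"
  shows "excess_ge b S m \<longleftrightarrow> excess_ge b' T m"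
proof -
  have q: "qform b S (\<lambda>i. y (L i)) = qform b' T y" for y
  proof -
    have "qform b S (\<lambda>i. y (L i)) = (\<Sum>i\<in>S. \<Sum>j\<in>S. b' (L i) (L j) * y (L i) * y (L j))"
      unfolding qform_def using eq by (intro sum.cong refl) simp
    also have "\<dots> = (\<Sum>i\<in>S. \<Sum>v\<in>T. b' (L i) v * y (L i) * y v)"
      by (intro sum.cong refl sum.reindex_bij_betw[OF L])
    also have "\<dots> = qform b' T y"
      unfolding qform_def by (rule sum.reindex_bij_betw[OF L])
    finally show ?thesis .
  qed
  show ?thesis
  proof
    assume "excess_ge b S m"
    then obtain x where x: "sign_vector x" "m \<le> qform b S x" by (auto simp: excess_ge_def)
    have "qform b' T (\<lambda>v. x (the_inv_into S L v)) = qform b S x"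
      unfolding q[symmetric] using L by (intro qform_cong) (auto simp: bij_betw_def the_inv_into_f_f)
    then show "excess_ge b' T m"
      using x by (auto simp: excess_ge_def sign_vector_def intro!: exI[of _ "\<lambda>v. x (the_inv_into S L v)"])
  next
    assume "excess_ge b' T m"
    then obtain y where "sign_vector y" "m \<le> qform b' T y" by (auto simp: excess_ge_def)
    then show "excess_ge b S m"
      by (auto simp: excess_ge_def sign_vector_def q intro!: exI[of _ "\<lambda>i. y (L i)"])
  qed
qed

definition graph_of_entries :: "nat \<Rightarrow> (nat \<Rightarrow> nat \<Rightarrow> nat) \<Rightarrow> nat sgraph" where
  "graph_of_entries n M = \<lparr>verts = {..<n},
     pos = {{i, j} |i j. i < n \<and> j < n \<and> i \<noteq> j \<and> M i j = 1},
     neg = {{i, j} |i j. i < n \<and> j < n \<and> i \<noteq> j \<and> M i j = 2}\<rparr>"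

lemma graph_of_entries:
  assumes "\<And>i j. M i j = M j i"
  shows "signed_graph (graph_of_entries n M)" and "verts (graph_of_entries n M) = {..<n}"
    and "{i, j} \<in> pos (graph_of_entries n M) \<longleftrightarrow> i < n \<and> j < n \<and> i \<noteq> j \<and> M i j = 1"
    and "{i, j} \<in> neg (graph_of_entries n M) \<longleftrightarrow> i < n \<and> j < n \<and> i \<noteq> j \<and> M i j = 2"
  using assms by (auto simp: graph_of_entries_def signed_graph_def edges_def doubleton_eq_iff)

lemma adj_entry_graph_of_entries:
  assumes "\<And>i j. M i j = M j i" "i < n" "j < n"
  shows "adj_entry (graph_of_entries n M) i j = (if i \<noteq> j \<and> M i j \<in> {1, 2} then M i j else 0)"
  unfolding adj_entry_def graph_of_entries(3,4)[of M, OF assms(1)] using assms(2,3) by auto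

text \<open>For a single positive edge and k = 1 the threshold is 1/2 + 1/4 + 1/4 = 1, attained by
  the whole graph.\<close>

lemma trivial_yes_instance:
  "smc_instance (graph_of_entries 2 (\<lambda>_ _. 1)) 1" "smc_yes (graph_of_entries 2 (\<lambda>_ _. 1)) 1"
proof -
  let ?G = "graph_of_entries 2 (\<lambda>_ _. 1)"
  have G: "signed_graph ?G" "verts ?G = {0, 1}"
    by (auto simp: graph_of_entries)
  interpret signed_matrix "sgraph_matrix ?G" by (rule signed_matrix_sgraph_matrix)
  have e: "{i, j} \<in> edges ?G" if "i < 2" "j < 2" "i \<noteq> j" for i j
    using that by (simp add: edges_def graph_of_entries)
  have "(u, v) \<in> {(x, y). {x, y} \<in> edges ?G}\<^sup>*" if "u < 2" "v < 2" for u v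
    using e[OF that] by (cases "u = v") auto
  then show "smc_instance ?G 1"
    using G by (auto simp: smc_instance_def connected_graph_def)
  have "excess_ge (sgraph_matrix ?G) {0, 1} 0"
    using e[of 0 1] G(1) by (intro excess_ge_edge) (auto simp: edge_iff_sgraph_matrix)
  then show "smc_yes ?G 1"
    using G by (simp add: smc_yes_iff_excess_ge)
qed

section \<open>Instances that arise by shrinking a twin class\<close>

lemma connected_graph_map:
  assumes conn: "connected_graph G" and "verts H \<noteq> {}"
    and into: "\<And>i. i \<in> verts H \<Longrightarrow> L i \<in> verts G \<and> \<rho> (L i) = i"
    and step: "\<And>u v. {u, v} \<in> edges G \<Longrightarrow> \<rho> u = \<rho> v \<or> {\<rho> u, \<rho> v} \<in> edges H"
  shows "connected_graph H"
proof -
  \<comment> \<open>Walks are projected by \<open>\<rho>\<close>; a step inside a fibre of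
    \<open>\<rho>\<close> becomes a standstill.\<close>
  have walk: "(u, v) \<in> {(x, y). {x, y} \<in> edges G}\<^sup>* \<Longrightarrow> (\<rho> u, \<rho> v) \<in> {(x, y). {x, y} \<in> edges H}\<^sup>*" for u v
  proof (induction rule: rtrancl_induct)
    case (step v w)
    then have "\<rho> v = \<rho> w \<or> (\<rho> v, \<rho> w) \<in> {(x, y). {x, y} \<in> edges H}"
      using assms(4) by auto
    then show ?case using step.IH by (metis rtrancl.rtrancl_into_rtrancl)
  qed simp
  show ?thesis
    using assms(2) into walk[of "L _" "L _"] conn unfolding connected_graph_def by metis
qed

lemma shrink_twin_class_instance:
  fixes G :: "nat sgraph"
  assumes inst: "smc_instance G k" and c: "c \<in> verts G"
    and X: "X = {u \<in> verts G. signed_matrix.twin (sgraph_matrix G) (verts G) c u}"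
    and X': "X' \<subseteq> X" "even (card X + card X')" "card (verts G - X) \<le> card X'" "X' \<noteq> {}"
    and L: "bij_betw L {..<m} (verts G - X \<union> X')"
    and H: "H = graph_of_entries m (\<lambda>i j. adj_entry G (L i) (L j))"
  shows "smc_instance H k \<and> (smc_yes G k \<longleftrightarrow> smc_yes H k)"
proof -
  let ?b = "sgraph_matrix G" and ?V = "verts G"
  interpret signed_matrix ?b by (rule signed_matrix_sgraph_matrix)
  have G: "signed_graph G" "connected_graph G" and k: "k > 0" and finV: "finite ?V"
    using inst by (auto simp: smc_instance_def signed_graph_def)
  have LV: "L i \<in> ?V" if "i < m" for i
    using bij_betw_apply[OF L] that X'(1) X by auto
  have "adj_entry G u v = adj_entry G v u" for u v by (simp add: adj_entry_def insert_commute)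
  note goe = graph_of_entries[where n = m and M = "\<lambda>i j. adj_entry G (L i) (L j)", OF this, folded H]
  have entry: "adj_entry G u v = 1 \<longleftrightarrow> {u, v} \<in> pos G"
    "adj_entry G u v = 2 \<longleftrightarrow> {u, v} \<notin> pos G \<and> {u, v} \<in> neg G" for u v
    by (simp_all add: adj_entry_def)
  have mat: "sgraph_matrix H i j = ?b (L i) (L j)" if "i \<in> {..<m}" "j \<in> {..<m}" for i j
  proof (cases "i = j")
    case False
    then have "L i \<noteq> L j" using that L by (auto simp: bij_betw_def inj_on_def)
    then show ?thesis
      using that False by (simp add: sgraph_matrix_def goe(3,4) entry del: One_nat_def)
  qed (simp add: sgraph_matrix_def)
  have "excess_ge ?b ?V e \<longleftrightarrow> excess_ge (sgraph_matrix H) (verts H) e" for e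
  proof -
    have VX: "?V - X \<union> X = ?V" using X by auto
    have "excess_ge ?b (?V - X \<union> X) e \<longleftrightarrow> excess_ge ?b (?V - X \<union> X') e"
    proof (rule excess_ge_shrink_twin_class)
      show "c \<in> X" using c X by (simp add: twin_def)
      show "twin (?V - X \<union> X) c u" if "u \<in> X" for u using that unfolding VX by (simp add: X)
    qed (use X' finV X in auto)
    also have "\<dots> \<longleftrightarrow> excess_ge (sgraph_matrix H) (verts H) e"
      unfolding goe using L mat by (rule excess_ge_reindex[symmetric])
    finally show ?thesis unfolding VX .
  qed
  then have yes: "smc_yes G k \<longleftrightarrow> smc_yes H k"
    using G(1) goe(1) by (simp add: smc_yes_iff_excess_ge)
  obtain c' where c': "c' \<in> X'" using X' by auto
  have twin0: "?b u w = 0 \<longleftrightarrow> ?b v w = 0" if "u \<in> X" "v \<in> X" "w \<in> ?V" for u v w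
    using that by (auto simp: X twin_def)
  have clique: "?b u v \<noteq> 0" if "u \<in> X" "v \<in> X" for u v
    using twin0[OF that, of v] that diag[of v] by (auto simp: X)
  \<comment> \<open>The retraction onto the kept vertices sends every deleted twin to one kept twin.
    Twins have nonzero entries in the same columns, so edges survive unless they collapse to a
    vertex.\<close>
  define \<sigma> where "\<sigma> u = (if u \<in> ?V - X \<union> X' then u else c')" for u
  have \<sigma>: "\<sigma> u \<in> ?V - X \<union> X'" for u using c' by (simp add: \<sigma>_def)
  have \<sigma>X: "u \<in> X \<and> \<sigma> u \<in> X \<or> \<sigma> u = u" if "u \<in> ?V" for u
    using that c' X'(1) by (auto simp: \<sigma>_def)
  have \<sigma>_edge: "\<sigma> u = \<sigma> v \<or> {\<sigma> u, \<sigma> v} \<in> edges G" if uv: "{u, v} \<in> edges G" for u v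
  proof -
    have V: "u \<in> ?V" "v \<in> ?V" using G(1) uv by (auto simp: signed_graph_def)
    have ne: "?b u v \<noteq> 0" using uv edge_iff_sgraph_matrix[OF G(1)] by blast
    have "?b (\<sigma> u) v \<noteq> 0" using \<sigma>X[OF V(1)] twin0[of u "\<sigma> u" v] ne V by auto
    moreover have "\<sigma> u \<in> ?V" using \<sigma>[of u] X'(1) X by auto
    ultimately have "?b (\<sigma> u) (\<sigma> v) \<noteq> 0"
      using \<sigma>X[OF V(2)] twin0[of v "\<sigma> v" "\<sigma> u"] sym by metis
    \<comment> \<open>A nonzero entry means an edge or the diagonal, which is the case where both
      ends were sent to the same vertex.\<close>
    then show ?thesis using edge_iff_sgraph_matrix[OF G(1)] by blast
  qed
  define \<rho> where "\<rho> u = the_inv_into {..<m} L (\<sigma> u)" for u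
  have \<rho>: "\<rho> u < m" "L (\<rho> u) = \<sigma> u" for u
    using \<sigma>[of u] L unfolding \<rho>_def
    by (metis bij_betw_def lessThan_iff subset_refl the_inv_into_into, metis bij_betw_def f_the_inv_into_f)
  have "connected_graph H"
  proof (rule connected_graph_map[OF G(2)])
    show "verts H \<noteq> {}" using \<rho>(1)[of c] by (auto simp: goe)
    show "L i \<in> ?V \<and> \<rho> (L i) = i" if "i \<in> verts H" for i
    proof -
      have "L i \<in> ?V - X \<union> X'" using that bij_betw_apply[OF L] by (simp add: goe)
      then have "\<sigma> (L i) = L i" by (simp add: \<sigma>_def)
      then show ?thesis using that LV L by (simp add: goe \<rho>_def bij_betw_def the_inv_into_f_f)
    qed
    show "\<rho> u = \<rho> v \<or> {\<rho> u, \<rho> v} \<in> edges H" if uv: "{u, v} \<in> edges G" for u v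
    proof -
      have "\<sigma> u = \<sigma> v \<or> ?b (\<sigma> u) (\<sigma> v) \<noteq> 0"
        using \<sigma>_edge[OF uv] edge_iff_sgraph_matrix[OF G(1)] by blast
      then show ?thesis
        using mat[of "\<rho> u" "\<rho> v"] \<rho> edge_iff_sgraph_matrix[OF goe(1)] by (auto simp: \<rho>_def)
    qed
  qed
  then show ?thesis using yes goe(1) k by (simp add: smc_instance_def)
qed

lemma split_graph_large_twin_class:
  fixes G :: "nat sgraph"
  assumes inst: "smc_instance G k" and split: "split_graph G" and no: "\<not> smc_yes G k"
    and large: "35 * k\<^sup>2 < card (verts G)"
  obtains c where "c \<in> verts G"
    "card (verts G) \<le> card {u \<in> verts G. signed_matrix.twin (sgraph_matrix G) (verts G) c u} + 35 * k\<^sup>2"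
proof -
  let ?b = "sgraph_matrix G"
  interpret signed_matrix ?b by (rule signed_matrix_sgraph_matrix)
  have G: "signed_graph G" "connected_graph G" and k: "k > 0" and finV: "finite (verts G)"
    using inst by (auto simp: smc_instance_def signed_graph_def)
  obtain K I where KI: "K \<union> I = verts G" "K \<inter> I = {}"
    and K: "\<forall>u \<in> K. \<forall>v \<in> K. u \<noteq> v \<longrightarrow> {u, v} \<in> edges G" and I: "\<forall>u \<in> I. \<forall>v \<in> I. {u, v} \<notin> edges G"
    using split by (auto simp: split_graph_def)
  \<comment> \<open>The size assumption excludes the one-vertex graph, so connectivity gives
    \<open>v\<close> a neighbour, which cannot lie in \<open>I\<close>.\<close>
  have nbr: "\<exists>u\<in>K. ?b v u \<noteq> 0" if v: "v \<in> I" for v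
  proof -
    have "k\<^sup>2 > 0" using k by simp
    then have "card (verts G) > 1" using large by linarith
    then obtain w where w: "w \<in> verts G" "w \<noteq> v"
      by (metis card_le_Suc0_iff_eq[OF finV] One_nat_def not_le v KI(1) UnI2)
    then have "(v, w) \<in> {(x, y). {x, y} \<in> edges G}\<^sup>*"
      using G(2) v KI(1) by (auto simp: connected_graph_def)
    then obtain u where u: "{v, u} \<in> edges G"
      using w(2) by (auto elim: converse_rtranclE)
    then have "u \<in> verts G" using G(1) by (auto simp: signed_graph_def)
    then have "u \<in> K" using u I v KI(1) by auto
    then show ?thesis using u edge_iff_sgraph_matrix[OF G(1)] by auto
  qed
  obtain c where "c \<in> K \<union> I" "card (K \<union> I) \<le> card {u \<in> K \<union> I. twin (K \<union> I) c u} + 35 * k\<^sup>2"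
  proof (rule large_twin_class[of K I k])
    show "\<not> excess_ge ?b (K \<union> I) (int k - 1)"
      using no G(1) KI(1) by (simp add: smc_yes_iff_excess_ge)
    show "?b u v \<noteq> 0" if "u \<in> K" "v \<in> K" "u \<noteq> v" for u v
      using that K edge_iff_sgraph_matrix[OF G(1)] by blast
    show "?b u v = 0" if "u \<in> I" "v \<in> I" "u \<noteq> v" for u v
      using that I edge_iff_sgraph_matrix[OF G(1)] by blast
    show "finite K" "finite I" using KI(1) finV by (metis finite_Un)+
  qed (use nbr KI large in auto)
  then show thesis using that KI(1) by simp
qed

section \<open>Running time of programs\<close>

text \<open>Total correctness with a time bound. Asking for one run is enough, since
  \<open>exec\<close> is deterministic.\<close>

definition runs :: "com \<Rightarrow> nat \<Rightarrow> state \<Rightarrow> (state \<Rightarrow> bool) \<Rightarrow> bool" where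
  "runs p T s Q \<longleftrightarrow> (\<exists>t s'. exec p s t s' \<and> t \<le> T \<and> Q s')"

lemma runs_weaken: "runs p T s Q \<Longrightarrow> T \<le> T' \<Longrightarrow> (\<And>s'. Q s' \<Longrightarrow> Q' s') \<Longrightarrow> runs p T' s Q'"
  unfolding runs_def by (meson order_trans)

lemma runs_Seq:
  assumes "runs p T1 s P" "\<And>s'. P s' \<Longrightarrow> runs q T2 s' Q"
  shows "runs (Seq p q) (T1 + T2) s Q"
  using assms unfolding runs_def by (meson add_mono exec.Seq)

lemma runs_If:
  assumes "bval b s \<Longrightarrow> runs p T s Q" "\<not> bval b s \<Longrightarrow> runs q T s Q"
  shows "runs (If b p q) (1 + T) s Q"
  using assms unfolding runs_def
  by (cases "bval b s") (meson add_left_mono exec.IfTrue, meson add_left_mono exec.IfFalse)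

text \<open>Loop-free code has a total evaluator \<open>run\<close> and a state-independent bound
  \<open>cost\<close>, so the simplifier can execute it symbolically and only loops need
  invariants.\<close>

fun loop_free :: "com \<Rightarrow> bool" where
  "loop_free (Seq p q) \<longleftrightarrow> loop_free p \<and> loop_free q"
| "loop_free (If b p q) \<longleftrightarrow> loop_free p \<and> loop_free q"
| "loop_free (While b p) \<longleftrightarrow> False"
| "loop_free p \<longleftrightarrow> True"

fun run :: "com \<Rightarrow> state \<Rightarrow> state" where
  "run (Assign x a e) s = s(x := (s x)(aval a s := aval e s))"
| "run (Seq p q) s = run q (run p s)"
| "run (If b p q) s = (if bval b s then run p s else run q s)"
| "run p s = s"

fun cost :: "com \<Rightarrow> nat" where
  "cost (Seq p q) = cost p + cost q"
| "cost (If b p q) = 1 + max (cost p) (cost q)"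
| "cost p = 1"

lemma runs_run: "loop_free p \<Longrightarrow> runs p (cost p) s (\<lambda>s'. s' = run p s)"
proof (induction p arbitrary: s)
  case (Seq p q)
  then show ?case by (auto intro!: runs_Seq[where P = "\<lambda>s'. s' = run p s"])
next
  case (If b p q)
  then have "runs p (cost p) s (\<lambda>s'. s' = run p s)" "runs q (cost q) s (\<lambda>s'. s' = run q s)"
    by simp_all
  then have "runs p (max (cost p) (cost q)) s (\<lambda>s'. s' = run p s)"
    "runs q (max (cost p) (cost q)) s (\<lambda>s'. s' = run q s)"
    by (auto elim: runs_weaken)
  then show ?case unfolding cost.simps by (intro runs_If) simp_all
qed (auto simp: runs_def intro: exec.intros)

lemma runs_loop_free:
  assumes "loop_free p" "cost p \<le> T" "Q (run p s)"
  shows "runs p T s Q"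
  using runs_weaken[OF runs_run[OF assms(1)] assms(2)] assms(3) by metis

lemma runs_loop_free_Seq:
  assumes "loop_free p" "cost p \<le> T1" "runs q T2 (run p s) Q"
  shows "runs (Seq p q) (T1 + T2) s Q"
  using assms by (auto intro: runs_Seq[OF runs_loop_free[where Q = "\<lambda>s'. s' = run p s"]])

section \<open>Counting loops and derived arithmetic\<close>

abbreviation var :: "vname \<Rightarrow> aexp" where
  "var x \<equiv> Read x (Const 0)"

abbreviation Set_var :: "vname \<Rightarrow> aexp \<Rightarrow> com" where
  "Set_var x e \<equiv> Assign x (Const 0) e"

abbreviation set_var :: "vname \<Rightarrow> nat \<Rightarrow> state \<Rightarrow> state" where
  "set_var x v s \<equiv> s(x := (s x)(0 := v))"

definition For :: "vname \<Rightarrow> vname \<Rightarrow> com \<Rightarrow> com" where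
  "For i n p = Seq (Set_var i (Const 0))
     (While (Less (var i) (var n)) (Seq p (Set_var i (Add (var i) (Const 1)))))"

text \<open>\<open>I j\<close> describes the state in which the counter has just been set to
  \<open>j\<close>. A pass adds one test and one increment to the body; the initial assignment and
  the failing test give the final 2.\<close>

lemma runs_For:
  assumes init: "I 0 (set_var i 0 s)"
    and body: "\<And>j s. j < N \<Longrightarrow> s i 0 = j \<Longrightarrow> I j s \<Longrightarrow>
      runs p T s (\<lambda>s'. s' i 0 = j \<and> I (Suc j) (set_var i (Suc j) s'))"
    and bound: "\<And>j s. I j s \<Longrightarrow> s n 0 = N"
  shows "runs (For i n p) (N * (T + 2) + 2) s (I N)"
proof -
  let ?w = "While (Less (var i) (var n)) (Seq p (Set_var i (Add (var i) (Const 1))))"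
  have "runs ?w (d * (T + 2) + 1) s (I N)" if "s i 0 + d = N" "I (s i 0) s" for d s
    using that
  proof (induction d arbitrary: s)
    case 0
    then have "\<not> bval (Less (var i) (var n)) s" using bound[OF 0(2)] by simp
    then show ?case using 0 unfolding runs_def by (auto intro!: exec.WhileFalse exI)
  next
    case (Suc d)
    have "bval (Less (var i) (var n)) s" using bound[OF Suc.prems(2)] Suc.prems(1) by simp
    moreover obtain t1 s1 where s1: "exec p s t1 s1" "t1 \<le> T" "s1 i 0 = s i 0"
      "I (Suc (s i 0)) (set_var i (Suc (s i 0)) s1)"
      using body[OF _ refl Suc.prems(2)] Suc.prems(1) by (auto simp: runs_def)
    moreover have "exec (Set_var i (Add (var i) (Const 1))) s1 1 (set_var i (Suc (s i 0)) s1)"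
      using exec.Assign[of i "Const 0" "Add (var i) (Const 1)" s1] s1(3) by simp
    moreover obtain t2 s2 where "exec ?w (set_var i (Suc (s i 0)) s1) t2 s2"
      "t2 \<le> d * (T + 2) + 1" "I N s2"
    proof -
      have "set_var i (Suc (s i 0)) s1 i 0 = Suc (s i 0)" by simp
      then have "runs ?w (d * (T + 2) + 1) (set_var i (Suc (s i 0)) s1) (I N)"
        using Suc.IH[of "set_var i (Suc (s i 0)) s1"] s1(4) Suc.prems(1) by (metis add_Suc add_Suc_right)
      then show thesis using that unfolding runs_def by blast
    qed
    ultimately have "exec ?w s (1 + (t1 + 1) + t2) s2" "t1 \<le> T" "t2 \<le> d * (T + 2) + 1" "I N s2"
      by (blast intro: exec.WhileTrue exec.Seq)+
    moreover from this have "1 + (t1 + 1) + t2 \<le> Suc d * (T + 2) + 1" by simp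
    ultimately show ?case unfolding runs_def by blast
  qed
  from this[of "set_var i 0 s" N] have "runs ?w (N * (T + 2) + 1) (set_var i 0 s) (I N)"
    using init by simp
  then have "runs (For i n p) (1 + (N * (T + 2) + 1)) s (I N)"
    unfolding For_def by (intro runs_loop_free_Seq) auto
  then show ?thesis by (rule runs_weaken) auto
qed

primrec Times :: "nat \<Rightarrow> aexp \<Rightarrow> aexp" where
  "Times 0 e = Const 0"
| "Times (Suc c) e = Add e (Times c e)"

lemma aval_Times [simp]: "aval (Times c e) s = c * aval e s"
  by (induction c) auto

text \<open>With truncated subtraction one summand always vanishes, so the expression is zero
  exactly for equal arguments.\<close>

definition abs_diff :: "aexp \<Rightarrow> aexp \<Rightarrow> aexp" where
  "abs_diff a b = Add (Sub a b) (Sub b a)"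

section \<open>The kernelization program\<close>

text \<open>\<open>R\<close> stores the row offsets, built by repeated addition. \<open>D\<close>
  receives 35 k once for every i below both n and k, so the loop runs n times however large k
  is.\<close>

definition Init :: com where
  "Init = For ''i'' ''n'' (Seq
     (Assign ''R'' (Add (var ''i'') (Const 1)) (Add (Read ''R'' (var ''i'')) (var ''n'')))
     (If (Less (var ''i'') (var ''k'')) (Set_var ''D'' (Add (var ''D'') (Times 35 (var ''k'')))) Skip))"

definition Diagonal :: com where
  "Diagonal = For ''i'' ''n'' (Assign ''A'' (Add (Read ''R'' (var ''i'')) (var ''i'')) (Const 2))"

abbreviation entry :: "vname \<Rightarrow> vname \<Rightarrow> aexp" where
  "entry i j \<equiv> Read ''A'' (Add (Read ''R'' (var i)) (var j))"

text \<open>\<open>x\<close> and \<open>y\<close> add up the distances of row j from row i and from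
  its negative. In truncated arithmetic, 2a - 3(a - 1) sends 0, 1, 2 to 0, 2, 1.\<close>

definition Compare :: com where
  "Compare = Seq (Seq (Set_var ''x'' (Const 0)) (Set_var ''y'' (Const 0))) (For ''l'' ''n'' (Seq
     (Set_var ''x'' (Add (var ''x'') (abs_diff (entry ''j'' ''l'') (entry ''i'' ''l''))))
     (Set_var ''y'' (Add (var ''y'') (abs_diff (entry ''j'' ''l'')
       (Sub (Times 2 (entry ''i'' ''l'')) (Times 3 (Sub (entry ''i'' ''l'') (Const 1)))))))))"

text \<open>\<open>W\<close> records the twin relation as a matrix; \<open>f\<close>,
  \<open>b\<close> and \<open>c\<close> remember the last row found whose class misses at most
  \<open>D\<close> vertices.\<close>

definition Twins :: com where
  "Twins = For ''i'' ''n'' (Seq (Seq (Set_var ''t'' (Const 0))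
     (For ''j'' ''n'' (Seq Compare
       (If (BNot (BAnd (Less (Const 0) (var ''x'')) (Less (Const 0) (var ''y''))))
         (Seq (Assign ''W'' (Add (Read ''R'' (var ''i'')) (var ''j'')) (Const 1))
           (Set_var ''t'' (Add (var ''t'') (Const 1))))
         (Assign ''W'' (Add (Read ''R'' (var ''i'')) (var ''j'')) (Const 0))))))
     (If (Less (Add (var ''t'') (var ''D'')) (var ''n'')) Skip
       (Seq (Set_var ''f'' (Const 1)) (Seq (Set_var ''b'' (var ''i'')) (Set_var ''c'' (var ''t''))))))"

definition Reduce :: com where
  "Reduce = For ''i'' ''n'' (If (Less (Add (var ''D'') (Const 1)) (var ''c''))
     (Set_var ''c'' (Sub (var ''c'') (Const 2))) Skip)"

definition Keep :: com where
  "Keep = Seq (Seq (Set_var ''q'' (Const 0)) (Set_var ''m'' (Const 0))) (For ''i'' ''n''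
     (If (BAnd (Less (Const 0) (Read ''W'' (Add (Read ''R'' (var ''b'')) (var ''i''))))
           (BNot (Less (var ''q'') (var ''c''))))
       Skip
       (Seq (Seq (Assign ''L'' (var ''m'') (var ''i'')) (Set_var ''m'' (Add (var ''m'') (Const 1))))
         (If (Less (Const 0) (Read ''W'' (Add (Read ''R'' (var ''b'')) (var ''i''))))
           (Set_var ''q'' (Add (var ''q'') (Const 1))) Skip))))"

definition Compact :: com where
  "Compact = Seq (Set_var ''p'' (Const 0)) (For ''i'' ''m'' (For ''j'' ''m'' (Seq
     (If (BAnd (BNot (Less (var ''i'') (var ''j''))) (BNot (Less (var ''j'') (var ''i''))))
       (Assign ''A'' (var ''p'') (Const 0))
       (Assign ''A'' (var ''p'') (Read ''A'' (Add (Read ''R'' (Read ''L'' (var ''i''))) (Read ''L'' (var ''j''))))))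
     (Set_var ''p'' (Add (var ''p'') (Const 1))))))"

definition Trivial :: com where
  "Trivial = Seq (Seq (Set_var ''n'' (Const 2)) (Set_var ''k'' (Const 1)))
     (Seq (Seq (Assign ''A'' (Const 0) (Const 0)) (Assign ''A'' (Const 1) (Const 1)))
       (Seq (Assign ''A'' (Const 2) (Const 1)) (Assign ''A'' (Const 3) (Const 0))))"

text \<open>If n exceeds 4D, a class missing at most D vertices has more than 3D members, so it can
  be cut to D or D + 1 members and still be at least as large as its complement. The diagonal is
  overwritten only behind this test, which leaves small instances intact.\<close>

definition Kernel :: com where
  "Kernel = Seq Init (If (Less (Times 4 (var ''D'')) (var ''n''))
     (Seq Diagonal (Seq Twins (If (Less (Const 0) (var ''f''))
       (Seq Reduce (Seq Keep (Seq Compact (Set_var ''n'' (var ''m'')))))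
       Trivial)))
     Skip)"

section \<open>Correctness and running time of the phases\<close>

lemma row_major_inject: "j < n \<Longrightarrow> j' < n \<Longrightarrow> i * n + j = i' * n + j' \<longleftrightarrow> i = i' \<and> j = j'" for n :: nat
  by (metis div_mult_self3 add.commute div_less mod_mult_self3 mod_less add_0 less_nat_zero_code not_gr0)

lemma card_less_Suc: "card {u. u < Suc n \<and> P u} = card {u. u < n \<and> P u} + (if P n then 1 else 0)"
proof -
  have "{u. u < Suc n \<and> P u} = {u. u < n \<and> P u} \<union> (if P n then {n} else {})"
    by (auto simp: less_Suc_eq)
  then show ?thesis by (simp add: card_insert_if)
qed

lemma runs_Init:
  assumes "s ''n'' 0 = n" "s ''k'' 0 = k" "s ''R'' 0 = 0" "s ''D'' 0 = 0" "s ''f'' 0 = 0"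
  shows "runs Init (n * 5 + 2) s (\<lambda>s'. s' ''n'' 0 = n \<and> s' ''k'' 0 = k \<and> s' ''A'' = s ''A'' \<and>
    s' ''f'' 0 = 0 \<and> (\<forall>i\<le>n. s' ''R'' i = i * n) \<and> s' ''D'' 0 = 35 * k * min n k)"
proof -
  define I where "I j s' \<longleftrightarrow> s' ''n'' 0 = n \<and> s' ''k'' 0 = k \<and> s' ''A'' = s ''A'' \<and>
    s' ''f'' 0 = 0 \<and> (\<forall>i\<le>j. s' ''R'' i = i * n) \<and> s' ''D'' 0 = 35 * k * min j k" for j and s' :: state
  have "runs Init (n * (3 + 2) + 2) s (I n)"
    unfolding Init_def
  proof (rule runs_For)
    fix j and s' :: state
    assume "j < n" "s' ''i'' 0 = j" "I j s'"
    then show "runs (Seq (Assign ''R'' (Add (var ''i'') (Const 1)) (Add (Read ''R'' (var ''i'')) (var ''n'')))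
       (If (Less (var ''i'') (var ''k'')) (Set_var ''D'' (Add (var ''D'') (Times 35 (var ''k'')))) Skip)) 3 s'
       (\<lambda>s'. s' ''i'' 0 = j \<and> I (Suc j) (set_var ''i'' (Suc j) s'))"
      by (intro runs_loop_free) (auto simp: I_def le_Suc_eq min_def)
  qed (use assms in \<open>auto simp: I_def\<close>)
  then show ?thesis by (rule runs_weaken) (auto simp: I_def)
qed

lemma runs_Diagonal:
  assumes "s ''n'' 0 = n" "s ''k'' 0 = k" "s ''f'' 0 = 0" "s ''D'' 0 = D" "\<forall>i\<le>n. s ''R'' i = i * n"
    and "\<forall>u<n. \<forall>v<n. s ''A'' (u * n + v) = A u v"
  shows "runs Diagonal (n * 3 + 2) s (\<lambda>s'. s' ''n'' 0 = n \<and> s' ''k'' 0 = k \<and> s' ''f'' 0 = 0 \<and>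
    s' ''D'' 0 = D \<and> (\<forall>i\<le>n. s' ''R'' i = i * n) \<and>
    (\<forall>u<n. \<forall>v<n. s' ''A'' (u * n + v) = (if u = v then 2 else A u v)))"
proof -
  define I where "I j s' \<longleftrightarrow> s' ''n'' 0 = n \<and> s' ''k'' 0 = k \<and> s' ''f'' 0 = 0 \<and>
    s' ''D'' 0 = D \<and> (\<forall>i\<le>n. s' ''R'' i = i * n) \<and>
    (\<forall>u<n. \<forall>v<n. s' ''A'' (u * n + v) = (if u = v \<and> u < j then 2 else A u v))" for j and s' :: state
  have "runs Diagonal (n * (1 + 2) + 2) s (I n)"
    unfolding Diagonal_def
  proof (rule runs_For)
    fix j and s' :: state
    assume "j < n" "s' ''i'' 0 = j" "I j s'"
    then show "runs (Assign ''A'' (Add (Read ''R'' (var ''i'')) (var ''i'')) (Const 2)) 1 s'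
       (\<lambda>s'. s' ''i'' 0 = j \<and> I (Suc j) (set_var ''i'' (Suc j) s'))"
      by (intro runs_loop_free) (auto simp: I_def row_major_inject)
  qed (use assms in \<open>auto simp: I_def\<close>)
  then show ?thesis by (rule runs_weaken) (auto simp: I_def)
qed

text \<open>Entries 0, 1, 2 encode the signs 0, 1, -1, and the diagonal is filled with 2, that is, with -1.\<close>

definition opposite_entry :: "nat \<Rightarrow> nat" where
  "opposite_entry a = 2 * a - 3 * (a - 1)"

definition twin_rows :: "nat \<Rightarrow> (nat \<Rightarrow> nat \<Rightarrow> nat) \<Rightarrow> nat \<Rightarrow> nat \<Rightarrow> bool" where
  "twin_rows n M c u \<longleftrightarrow> (\<forall>w<n. M u w = M c w) \<or> (\<forall>w<n. M u w = opposite_entry (M c w))"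

abbreviation twin_count :: "nat \<Rightarrow> (nat \<Rightarrow> nat \<Rightarrow> nat) \<Rightarrow> nat \<Rightarrow> nat \<Rightarrow> nat" where
  "twin_count n M c j \<equiv> card {u. u < j \<and> twin_rows n M c u}"

definition matrix_state :: "nat \<Rightarrow> nat \<Rightarrow> nat \<Rightarrow> (nat \<Rightarrow> nat \<Rightarrow> nat) \<Rightarrow> state \<Rightarrow> bool" where
  "matrix_state n k D M s \<longleftrightarrow> s ''n'' 0 = n \<and> s ''k'' 0 = k \<and> s ''D'' 0 = D \<and>
    (\<forall>i\<le>n. s ''R'' i = i * n) \<and> (\<forall>u<n. \<forall>v<n. s ''A'' (u * n + v) = M u v)"

lemma matrix_state_entry:
  "matrix_state n k D M s \<Longrightarrow> u < n \<Longrightarrow> v < n \<Longrightarrow> s ''A'' (s ''R'' u + v) = M u v"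
  by (simp add: matrix_state_def)

text \<open>Frame rule: phases that write only to other arrays keep the matrix and its
  parameters.\<close>

lemma matrix_state_cong:
  assumes "s' ''n'' = s ''n''" "s' ''k'' = s ''k''" "s' ''D'' = s ''D''" "s' ''R'' = s ''R''" "s' ''A'' = s ''A''"
  shows "matrix_state n k D M s' \<longleftrightarrow> matrix_state n k D M s"
  using assms by (simp add: matrix_state_def)

lemma matrix_state_Assign [simp]:
  "x \<notin> {''n'', ''k'', ''D'', ''R'', ''A''} \<Longrightarrow> matrix_state n k D M (s(x := v)) \<longleftrightarrow> matrix_state n k D M s"
  by (rule matrix_state_cong) auto

lemma runs_Compare:
  assumes "matrix_state n k D M s" "s ''i'' 0 = i" "s ''j'' 0 = j" "i < n" "j < n"
  shows "runs Compare (n * 4 + 4) s (\<lambda>s'. (\<forall>x. x \<notin> {''x'', ''y'', ''l''} \<longrightarrow> s' x = s x) \<and>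
    (s' ''x'' 0 = 0 \<longleftrightarrow> (\<forall>w<n. M j w = M i w)) \<and>
    (s' ''y'' 0 = 0 \<longleftrightarrow> (\<forall>w<n. M j w = opposite_entry (M i w))))"
proof -
  define I where "I l s' \<longleftrightarrow> (\<forall>x. x \<notin> {''x'', ''y'', ''l''} \<longrightarrow> s' x = s x) \<and>
    (s' ''x'' 0 = 0 \<longleftrightarrow> (\<forall>w<l. M j w = M i w)) \<and>
    (s' ''y'' 0 = 0 \<longleftrightarrow> (\<forall>w<l. M j w = opposite_entry (M i w)))" for l and s' :: state
  let ?p = "Seq
     (Set_var ''x'' (Add (var ''x'') (abs_diff (entry ''j'' ''l'') (entry ''i'' ''l''))))
     (Set_var ''y'' (Add (var ''y'') (abs_diff (entry ''j'' ''l'')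
       (Sub (Times 2 (entry ''i'' ''l'')) (Times 3 (Sub (entry ''i'' ''l'') (Const 1)))))))"
  let ?i = "Seq (Set_var ''x'' (Const 0)) (Set_var ''y'' (Const 0))"
  have "runs (For ''l'' ''n'' ?p) (n * (2 + 2) + 2) (run ?i s) (I n)"
  proof (rule runs_For)
    fix l and s' :: state
    assume l: "l < n" "s' ''l'' 0 = l" and I: "I l s'"
    have ij: "s' ''i'' 0 = i" "s' ''j'' 0 = j" "matrix_state n k D M s'"
      using I assms(1-3) matrix_state_cong[of s' s] by (simp_all add: I_def)
    have e: "s' ''A'' (s' ''R'' i + l) = M i l" "s' ''A'' (s' ''R'' j + l) = M j l"
      using matrix_state_entry[OF ij(3)] assms(4,5) l(1) by auto
    show "runs ?p 2 s' (\<lambda>s'. s' ''l'' 0 = l \<and> I (Suc l) (set_var ''l'' (Suc l) s'))"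
    proof (rule runs_loop_free)
      define dx where "dx = (M j l - M i l) + (M i l - M j l)"
      define dy where "dy = (M j l - opposite_entry (M i l)) + (opposite_entry (M i l) - M j l)"
      have "run ?p s' = set_var ''y'' (s' ''y'' 0 + dy) (set_var ''x'' (s' ''x'' 0 + dx) s')"
        using l ij e by (simp add: abs_diff_def opposite_entry_def dx_def dy_def)
      moreover have "dx = 0 \<longleftrightarrow> M j l = M i l" "dy = 0 \<longleftrightarrow> M j l = opposite_entry (M i l)"
        by (auto simp: dx_def dy_def)
      ultimately show "run ?p s' ''l'' 0 = l \<and> I (Suc l) (set_var ''l'' (Suc l) (run ?p s'))"
        using I l by (simp add: I_def All_less_Suc conj_commute del: run.simps)
    qed auto
  next
    show "I 0 (set_var ''l'' 0 (run ?i s))" by (simp add: I_def)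
    show "s' ''n'' 0 = n" if "I j s'" for j s'
      using that assms(1) by (simp add: I_def matrix_state_def)
  qed
  then have "runs Compare (2 + (n * (2 + 2) + 2)) s (I n)"
    unfolding Compare_def by (intro runs_loop_free_Seq) auto
  then show ?thesis by (rule runs_weaken) (auto simp: I_def)
qed

definition twins_done :: "nat \<Rightarrow> (nat \<Rightarrow> nat \<Rightarrow> nat) \<Rightarrow> nat \<Rightarrow> nat \<Rightarrow> state \<Rightarrow> bool" where
  "twins_done n M D i s \<longleftrightarrow>
     (\<forall>c<i. \<forall>u<n. s ''W'' (c * n + u) = (if twin_rows n M c u then 1 else 0)) \<and>
     (s ''f'' 0 = 0 \<longrightarrow> (\<forall>c<i. \<not> n \<le> twin_count n M c n + D)) \<and>
     (s ''f'' 0 \<noteq> 0 \<longrightarrow> s ''b'' 0 < i \<and> s ''c'' 0 = twin_count n M (s ''b'' 0) n \<and> n \<le> s ''c'' 0 + D)"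

lemma runs_Twins:
  assumes ms: "matrix_state n k D M s" and f: "s ''f'' 0 = 0"
  shows "runs Twins (n * (n * (4 * n + 9) + 9) + 2) s (\<lambda>s'. matrix_state n k D M s' \<and> twins_done n M D n s')"
proof -
  define I where "I i s' \<longleftrightarrow> matrix_state n k D M s' \<and> twins_done n M D i s'" for i and s' :: state
  \<comment> \<open>The inner invariant is relative to the state \<open>s0\<close> at the start of
    the row, so \<open>f\<close>, \<open>b\<close>, \<open>c\<close> and the finished rows of
    \<open>W\<close> are carried through unchanged.\<close>
  define J where "J i s0 j s' \<longleftrightarrow> (\<forall>x. x \<notin> {''x'', ''y'', ''l'', ''t'', ''j'', ''W''} \<longrightarrow> s' x = s0 x) \<and>
    s' ''t'' 0 = twin_count n M i j \<and>
    (\<forall>c<i. \<forall>u<n. s' ''W'' (c * n + u) = s0 ''W'' (c * n + u)) \<and>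
    (\<forall>u<j. s' ''W'' (i * n + u) = (if twin_rows n M i u then 1 else 0))" for i j and s0 s' :: state
  let ?if = "If (BNot (BAnd (Less (Const 0) (var ''x'')) (Less (Const 0) (var ''y''))))
         (Seq (Assign ''W'' (Add (Read ''R'' (var ''i'')) (var ''j'')) (Const 1))
           (Set_var ''t'' (Add (var ''t'') (Const 1))))
         (Assign ''W'' (Add (Read ''R'' (var ''i'')) (var ''j'')) (Const 0))"
  let ?in = "For ''j'' ''n'' (Seq Compare ?if)"
  let ?t = "Set_var ''t'' (Const 0)"
  let ?last = "If (Less (Add (var ''t'') (var ''D'')) (var ''n'')) Skip
       (Seq (Set_var ''f'' (Const 1)) (Seq (Set_var ''b'' (var ''i'')) (Set_var ''c'' (var ''t''))))"
  have inner: "runs ?in (n * ((n * 4 + 4 + 3) + 2) + 2) (run ?t s0) (J i s0 n)"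
    if i: "i < n" "s0 ''i'' 0 = i" and ms0: "matrix_state n k D M s0" for i s0
  proof (rule runs_For)
    fix j and s' :: state
    assume j: "j < n" "s' ''j'' 0 = j" and J: "J i s0 j s'"
    have ms': "matrix_state n k D M s'" "s' ''i'' 0 = i"
      using J ms0 i matrix_state_cong[of s' s0] by (simp_all add: J_def)
    show "runs (Seq Compare ?if) (n * 4 + 4 + 3) s'
      (\<lambda>s'. s' ''j'' 0 = j \<and> J i s0 (Suc j) (set_var ''j'' (Suc j) s'))"
    proof (rule runs_Seq[OF runs_Compare[OF ms' j(2) i(1) j(1)]])
      fix s1 :: state
      assume s1: "(\<forall>x. x \<notin> {''x'', ''y'', ''l''} \<longrightarrow> s1 x = s' x) \<and>
        (s1 ''x'' 0 = 0 \<longleftrightarrow> (\<forall>w<n. M j w = M i w)) \<and>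
        (s1 ''y'' 0 = 0 \<longleftrightarrow> (\<forall>w<n. M j w = opposite_entry (M i w)))"
      then have tw: "s1 ''x'' 0 = 0 \<or> s1 ''y'' 0 = 0 \<longleftrightarrow> twin_rows n M i j"
        by (simp add: twin_rows_def)
      have R: "s1 ''R'' i = i * n" "s1 ''i'' 0 = i" "s1 ''j'' 0 = j"
        using s1 ms' j i(1) by (simp_all add: matrix_state_def)
      have run: "run ?if s1 = (if twin_rows n M i j
          then set_var ''t'' (s1 ''t'' 0 + 1) (s1(''W'' := (s1 ''W'')(i * n + j := 1)))
          else s1(''W'' := (s1 ''W'')(i * n + j := 0)))"
        using R tw by auto
      show "runs ?if 3 s1 (\<lambda>s'. s' ''j'' 0 = j \<and> J i s0 (Suc j) (set_var ''j'' (Suc j) s'))"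
      proof (rule runs_loop_free)
        show "run ?if s1 ''j'' 0 = j \<and> J i s0 (Suc j) (set_var ''j'' (Suc j) (run ?if s1))"
          unfolding run
          using s1 J j(1) R(3) by (auto simp: J_def row_major_inject less_Suc_eq card_less_Suc[of j "twin_rows n M i", unfolded less_Suc_eq])
      qed auto
    qed
  next
    show "J i s0 0 (set_var ''j'' 0 (run ?t s0))" by (simp add: J_def)
    show "s' ''n'' 0 = n" if "J i s0 j s'" for j s'
      using that ms0 by (simp add: J_def matrix_state_def)
  qed
  have "runs Twins (n * ((1 + (n * ((n * 4 + 4 + 3) + 2) + 2) + 4) + 2) + 2) s (I n)"
    unfolding Twins_def Compare_def[symmetric]
  proof (rule runs_For)
    fix i and s' :: state
    assume i: "i < n" "s' ''i'' 0 = i" and I: "I i s'"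
    then have ms': "matrix_state n k D M s'" by (simp add: I_def)
    show "runs (Seq (Seq ?t ?in) ?last) (1 + (n * ((n * 4 + 4 + 3) + 2) + 2) + 4) s'
        (\<lambda>s'. s' ''i'' 0 = i \<and> I (Suc i) (set_var ''i'' (Suc i) s'))"
    proof (rule runs_Seq[where P = "J i s' n"])
      show "runs (Seq ?t ?in) (1 + (n * ((n * 4 + 4 + 3) + 2) + 2)) s' (J i s' n)"
        by (intro runs_loop_free_Seq inner[OF i ms']) auto
      fix s1 :: state assume J: "J i s' n s1"
      then have s1: "s1 ''n'' 0 = n" "s1 ''D'' 0 = D" "s1 ''i'' 0 = i" "matrix_state n k D M s1"
        "s1 ''t'' 0 = twin_count n M i n" "s1 ''f'' = s' ''f''" "s1 ''b'' = s' ''b''" "s1 ''c'' = s' ''c''"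
        using ms' i matrix_state_cong[of s1 s'] by (simp_all add: J_def matrix_state_def)
      have W: "\<forall>c<Suc i. \<forall>u<n. s1 ''W'' (c * n + u) = (if twin_rows n M c u then 1 else 0)"
        using J I by (auto simp: J_def I_def twins_done_def less_Suc_eq)
      have run: "run ?last s1 = (if n \<le> twin_count n M i n + D
          then set_var ''c'' (twin_count n M i n) (set_var ''b'' i (set_var ''f'' 1 s1)) else s1)"
        using s1 by (auto simp: not_less)
      show "runs ?last 4 s1 (\<lambda>s'. s' ''i'' 0 = i \<and> I (Suc i) (set_var ''i'' (Suc i) s'))"
      proof (rule runs_loop_free)
        show "run ?last s1 ''i'' 0 = i \<and> I (Suc i) (set_var ''i'' (Suc i) (run ?last s1))"
          unfolding run using s1 W I by (auto simp: I_def twins_done_def less_Suc_eq)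
      qed auto
    qed
  next
    show "I 0 (set_var ''i'' 0 s)" using ms f by (simp add: I_def twins_done_def)
    show "s' ''n'' 0 = n" if "I j s'" for j s'
      using that by (simp add: I_def matrix_state_def)
  qed
  then show ?thesis by (rule runs_weaken) (auto simp: I_def algebra_simps)
qed

lemma runs_Reduce:
  assumes ms: "matrix_state n k D M s" and c: "s ''c'' 0 = c" "c \<le> n" "D \<le> c"
  shows "runs Reduce (n * 4 + 2) s (\<lambda>s'. (\<forall>x. x \<notin> {''c'', ''i''} \<longrightarrow> s' x = s x) \<and>
    even (c + s' ''c'' 0) \<and> D \<le> s' ''c'' 0 \<and> s' ''c'' 0 \<le> D + 1)"
proof -
  \<comment> \<open>As long as \<open>c\<close> is above D + 1, every pass has removed 2. After n
    passes the second alternative says that the new value plus 2n is at most \<open>c\<close>, hence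
    at most n, which forces the value 0 and thus the first alternative.\<close>
  define I where "I j s' \<longleftrightarrow> (\<forall>x. x \<notin> {''c'', ''i''} \<longrightarrow> s' x = s x) \<and>
    even (c + s' ''c'' 0) \<and> D \<le> s' ''c'' 0 \<and> (s' ''c'' 0 \<le> D + 1 \<or> s' ''c'' 0 + 2 * j \<le> c)" for j and s' :: state
  have D: "s ''D'' 0 = D" "s ''n'' 0 = n" using ms by (auto simp: matrix_state_def)
  let ?p = "If (Less (Add (var ''D'') (Const 1)) (var ''c'')) (Set_var ''c'' (Sub (var ''c'') (Const 2))) Skip"
  have "runs Reduce (n * (2 + 2) + 2) s (I n)"
    unfolding Reduce_def
  proof (rule runs_For)
    fix j and s' :: state
    assume j: "s' ''i'' 0 = j" and I: "I j s'"
    have D': "s' ''D'' 0 = D" using D I by (simp add: I_def)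
    show "runs ?p 2 s' (\<lambda>s'. s' ''i'' 0 = j \<and> I (Suc j) (set_var ''i'' (Suc j) s'))"
    proof (rule runs_loop_free)
      show "run ?p s' ''i'' 0 = j \<and> I (Suc j) (set_var ''i'' (Suc j) (run ?p s'))"
      proof (cases "D + 1 < s' ''c'' 0")
        case True
        then have "s' ''c'' 0 = (s' ''c'' 0 - 2) + 2" "D \<le> s' ''c'' 0 - 2" by simp_all
        then obtain d where d: "s' ''c'' 0 = d + 2" "D \<le> d" by blast
        have "run ?p s' = set_var ''c'' d s'" using True D' d by simp
        then show ?thesis using True I j D' d by (simp add: I_def)
      next
        case False
        then show ?thesis using I j D' by (auto simp: I_def)
      qed
    qed auto
  qed (use c D in \<open>auto simp: I_def\<close>)
  moreover have "(\<forall>x. x \<notin> {''c'', ''i''} \<longrightarrow> s' x = s x) \<and>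
    even (c + s' ''c'' 0) \<and> D \<le> s' ''c'' 0 \<and> s' ''c'' 0 \<le> D + 1" if I: "I n s'" for s'
  proof -
    have "s' ''c'' 0 \<le> D + 1" using I c(2) unfolding I_def by linarith
    then show ?thesis using I unfolding I_def by blast
  qed
  ultimately show ?thesis by (elim runs_weaken) simp_all
qed

lemma bij_betw_fun_upd_Suc:
  "bij_betw f {..<m} K \<Longrightarrow> i \<notin> K \<Longrightarrow> bij_betw (f(m := i)) {..<Suc m} (insert i K)"
  by (auto simp: bij_betw_def inj_on_def lessThan_Suc image_iff)

text \<open>\<open>twin_count\<close> at \<open>u\<close> counts the twins before \<open>u\<close>:
  all other vertices stay, together with the first \<open>c\<close> twins.\<close>

definition kept :: "nat \<Rightarrow> (nat \<Rightarrow> nat \<Rightarrow> nat) \<Rightarrow> nat \<Rightarrow> nat \<Rightarrow> nat \<Rightarrow> nat set" where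
  "kept n M b c i = {u. u < i \<and> (twin_rows n M b u \<longrightarrow> twin_count n M b u < c)}"

lemma kept_Suc:
  "kept n M b c (Suc i) = (if twin_rows n M b i \<and> \<not> twin_count n M b i < c
     then kept n M b c i else insert i (kept n M b c i))"
  by (auto simp: kept_def less_Suc_eq)

lemma card_kept_twins:
  "card {u. u < i \<and> twin_rows n M b u \<and> twin_count n M b u < c} = min c (twin_count n M b i)"
proof (induction i)
  case (Suc i)
  then show ?case
    using card_less_Suc[of i "\<lambda>u. twin_rows n M b u \<and> twin_count n M b u < c"]
      card_less_Suc[of i "twin_rows n M b"] by auto
qed simp

text \<open>When vertex i is listed, at most i vertices precede it in the list. The resulting bound
  \<open>r \<le> L r\<close> is what allows compaction in place.\<close>

lemma runs_Keep:
  assumes ms: "matrix_state n k D M s" and b: "s ''b'' 0 = b" "b < n" and c: "s ''c'' 0 = c"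
    and W: "\<forall>u<n. s ''W'' (b * n + u) = (if twin_rows n M b u then 1 else 0)"
  shows "runs Keep (n * 7 + 4) s (\<lambda>s'. matrix_state n k D M s' \<and> s' ''m'' 0 \<le> n \<and>
    bij_betw (s' ''L'') {..<s' ''m'' 0} (kept n M b c n) \<and> (\<forall>r<s' ''m'' 0. r \<le> s' ''L'' r))"
proof -
  define I where "I i s' \<longleftrightarrow> (\<forall>x. x \<notin> {''q'', ''m'', ''L'', ''i''} \<longrightarrow> s' x = s x) \<and>
    s' ''q'' 0 = min c (twin_count n M b i) \<and> s' ''m'' 0 \<le> i \<and>
    bij_betw (s' ''L'') {..<s' ''m'' 0} (kept n M b c i) \<and> (\<forall>r<s' ''m'' 0. r \<le> s' ''L'' r)"
    for i and s' :: state
  let ?w = "Less (Const 0) (Read ''W'' (Add (Read ''R'' (var ''b'')) (var ''i'')))"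
  let ?p = "If (BAnd ?w (BNot (Less (var ''q'') (var ''c''))))
       Skip
       (Seq (Seq (Assign ''L'' (var ''m'') (var ''i'')) (Set_var ''m'' (Add (var ''m'') (Const 1))))
         (If ?w (Set_var ''q'' (Add (var ''q'') (Const 1))) Skip))"
  let ?i = "Seq (Set_var ''q'' (Const 0)) (Set_var ''m'' (Const 0))"
  have "runs (For ''i'' ''n'' ?p) (n * (5 + 2) + 2) (run ?i s) (I n)"
  proof (rule runs_For)
    fix i and s' :: state
    assume i: "i < n" "s' ''i'' 0 = i" and I: "I i s'"
    have s': "s' ''b'' 0 = b" "s' ''c'' 0 = c" "s' ''R'' b = b * n"
      "s' ''W'' (b * n + i) = (if twin_rows n M b i then 1 else 0)"
      using I b c W ms i(1) by (simp_all add: I_def matrix_state_def)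
    let ?tw = "twin_rows n M b i" and ?q = "twin_count n M b i"
    define m where "m = s' ''m'' 0"
    have q: "s' ''q'' 0 = min c ?q" "m \<le> i" "bij_betw (s' ''L'') {..<m} (kept n M b c i)"
      "\<forall>r<m. r \<le> s' ''L'' r" "\<And>x. x \<notin> {''q'', ''m'', ''L'', ''i''} \<Longrightarrow> s' x = s x"
      using I by (auto simp: I_def m_def)
    note cnt = card_less_Suc[of i "twin_rows n M b"]
    show "runs ?p 5 s' (\<lambda>s'. s' ''i'' 0 = i \<and> I (Suc i) (set_var ''i'' (Suc i) s'))"
    proof (rule runs_loop_free)
      show "run ?p s' ''i'' 0 = i \<and> I (Suc i) (set_var ''i'' (Suc i) (run ?p s'))"
      proof (cases "?tw \<and> \<not> ?q < c")
        case True
        then have "run ?p s' = s'" using s' i q(1) by simp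
        then show ?thesis
          using True I i(2) kept_Suc[of n M b c i] cnt by (simp add: I_def)
      next
        case False
        define s1 where "s1 = s'(''L'' := (s' ''L'')(m := i), ''m'' := (s' ''m'')(0 := Suc m))"
        have run: "run ?p s' = (if ?tw then set_var ''q'' (Suc (s' ''q'' 0)) s1 else s1)"
          using False s' i q(1) by (auto simp: s1_def m_def)
        have "i \<notin> kept n M b c i" by (simp add: kept_def)
        then have L: "bij_betw ((s' ''L'')(m := i)) {..<Suc m} (kept n M b c (Suc i))"
          using False kept_Suc[of n M b c i] bij_betw_fun_upd_Suc[OF q(3)] by auto
        have r: "r \<le> ((s' ''L'')(m := i)) r" if "r < Suc m" for r
          using that q(2,4) by (auto simp: less_Suc_eq)
        have "?tw \<Longrightarrow> min c (Suc ?q) = Suc ?q" using False by simp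
        then show ?thesis
          unfolding run I_def using L r q i False cnt by (simp add: s1_def)
      qed
    qed auto
  next
    show "I 0 (set_var ''i'' 0 (run ?i s))" by (simp add: I_def kept_def bij_betw_def)
    show "s' ''n'' 0 = n" if "I j s'" for j s'
      using that ms by (simp add: I_def matrix_state_def)
  qed
  then have *: "runs Keep (2 + (n * (5 + 2) + 2)) s (I n)"
    unfolding Keep_def by (intro runs_loop_free_Seq) auto
  have "matrix_state n k D M s'" if "I n s'" for s'
    using that ms matrix_state_cong[of s' s] by (simp add: I_def)
  then show ?thesis by (intro runs_weaken[OF *]) (auto simp: I_def)
qed

text \<open>The new matrix overwrites the old one. The write position advances in row-major order of
  the smaller matrix and never passes the cell still to be read. Writing 0 on the diagonal removes
  the filled-in entries.\<close>

lemma runs_Compact: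
  assumes ms: "matrix_state n k D M s" and m: "s ''m'' 0 = m" "m \<le> n" and L: "s ''L'' = L"
    and L_less: "\<And>r. r < m \<Longrightarrow> L r < n" and L_ge: "\<And>r. r < m \<Longrightarrow> r \<le> L r"
  shows "runs Compact (n * (n * 5 + 4) + 3) s (\<lambda>s'. s' ''m'' 0 = m \<and> s' ''k'' 0 = k \<and>
    (\<forall>i<m. \<forall>j<m. s' ''A'' (i * m + j) = (if i = j then 0 else M (L i) (L j))))"
proof -
  define J where "J i j s' \<longleftrightarrow> (\<forall>x. x \<notin> {''p'', ''i'', ''j'', ''A''} \<longrightarrow> s' x = s x) \<and>
    s' ''p'' 0 = i * m + j \<and>
    (\<forall>q\<ge>i * m + j. s' ''A'' q = s ''A'' q) \<and>
    (\<forall>i'<i. \<forall>j'<m. s' ''A'' (i' * m + j') = (if i' = j' then 0 else M (L i') (L j'))) \<and>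
    (\<forall>j'<j. s' ''A'' (i * m + j') = (if i = j' then 0 else M (L i) (L j')))" for i j and s' :: state
  let ?p = "Seq
     (If (BAnd (BNot (Less (var ''i'') (var ''j''))) (BNot (Less (var ''j'') (var ''i''))))
       (Assign ''A'' (var ''p'') (Const 0))
       (Assign ''A'' (var ''p'') (Read ''A'' (Add (Read ''R'' (Read ''L'' (var ''i''))) (Read ''L'' (var ''j''))))))
     (Set_var ''p'' (Add (var ''p'') (Const 1)))"
  have bound: "s' ''m'' 0 = m" if "J i j s'" for i j s' using that m by (simp add: J_def)
  have "runs (For ''i'' ''m'' (For ''j'' ''m'' ?p)) (m * ((m * (3 + 2) + 2) + 2) + 2)
      (run (Set_var ''p'' (Const 0)) s) (\<lambda>s'. J m 0 s')"
  proof (rule runs_For[where I = "\<lambda>i. J i 0"])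
    fix i and s0 :: state
    assume i: "i < m" "s0 ''i'' 0 = i" and J0: "J i 0 s0"
    have "runs (For ''j'' ''m'' ?p) (m * (3 + 2) + 2) s0 (\<lambda>s'. s' ''i'' 0 = i \<and> J i m s')"
    proof (rule runs_For[where I = "\<lambda>j s'. s' ''i'' 0 = i \<and> J i j s'"])
      fix j and s' :: state
      assume j: "j < m" "s' ''j'' 0 = j" and J: "s' ''i'' 0 = i \<and> J i j s'"
      define v where "v = (if i = j then 0 else M (L i) (L j))"
      \<comment> \<open>The source lies at or beyond the write position, hence in the part of
        \<open>A\<close> that the invariant declares untouched.\<close>
      have "i * m + j \<le> L i * n + L j"
        using L_ge[OF i(1)] L_ge[OF j(1)] m(2) by (intro add_mono mult_mono) auto
      then have "s' ''A'' (L i * n + L j) = M (L i) (L j)"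
        using J ms L_less[OF i(1)] L_less[OF j(1)] by (simp add: J_def matrix_state_def)
      moreover have "s' ''R'' (L i) = L i * n" "s' ''L'' = L" "s' ''p'' 0 = i * m + j"
        using J ms L L_less[OF i(1)] by (simp_all add: J_def matrix_state_def)
      ultimately have run: "run ?p s' = set_var ''p'' (Suc (i * m + j)) (s'(''A'' := (s' ''A'')(i * m + j := v)))"
        using j(2) J by (simp add: v_def)
      have A: "\<And>q. i * m + j \<le> q \<Longrightarrow> s' ''A'' q = s ''A'' q"
        "\<And>i' j'. i' < i \<Longrightarrow> j' < m \<Longrightarrow> s' ''A'' (i' * m + j') = (if i' = j' then 0 else M (L i') (L j'))"
        "\<And>j'. j' < j \<Longrightarrow> s' ''A'' (i * m + j') = (if i = j' then 0 else M (L i) (L j'))"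
        using J unfolding J_def by blast+
      let ?A = "(s' ''A'')(i * m + j := v)"
      have A': "\<forall>q\<ge>Suc (i * m + j). ?A q = s ''A'' q"
        "\<forall>i'<i. \<forall>j'<m. ?A (i' * m + j') = (if i' = j' then 0 else M (L i') (L j'))"
        "\<forall>j'<Suc j. ?A (i * m + j') = (if i = j' then 0 else M (L i) (L j'))"
        using A j(1) by (auto simp: row_major_inject less_Suc_eq v_def)
      show "runs ?p 3 s' (\<lambda>s'. s' ''j'' 0 = j \<and>
          (set_var ''j'' (Suc j) s') ''i'' 0 = i \<and> J i (Suc j) (set_var ''j'' (Suc j) s'))"
      proof (rule runs_loop_free)
        show "run ?p s' ''j'' 0 = j \<and> (set_var ''j'' (Suc j) (run ?p s')) ''i'' 0 = i \<and>
            J i (Suc j) (set_var ''j'' (Suc j) (run ?p s'))"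
          unfolding run J_def using J j(2) A' by (simp add: J_def)
      qed auto
    next
      show "set_var ''j'' 0 s0 ''i'' 0 = i \<and> J i 0 (set_var ''j'' 0 s0)"
        using J0 i by (simp add: J_def)
      show "s' ''m'' 0 = m" if "s' ''i'' 0 = i \<and> J i j s'" for j s' using that bound by blast
    qed
    then show "runs (For ''j'' ''m'' ?p) (m * (3 + 2) + 2) s0
        (\<lambda>s'. s' ''i'' 0 = i \<and> J (Suc i) 0 (set_var ''i'' (Suc i) s'))"
    proof (rule runs_weaken[OF _ order_refl])
      fix s' assume "s' ''i'' 0 = i \<and> J i m s'"
      then show "s' ''i'' 0 = i \<and> J (Suc i) 0 (set_var ''i'' (Suc i) s')"
        by (simp add: J_def All_less_Suc add.commute[of m] del: add_eq_if)
    qed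
  next
    show "J 0 0 (set_var ''i'' 0 (run (Set_var ''p'' (Const 0)) s))" by (simp add: J_def)
  qed (rule bound)
  then have "runs Compact (1 + (m * ((m * (3 + 2) + 2) + 2) + 2)) s (\<lambda>s'. J m 0 s')"
    unfolding Compact_def by (intro runs_loop_free_Seq) auto
  moreover have "m * (m * 5 + 4) \<le> n * (n * 5 + 4)" using m(2) by (intro mult_mono) auto
  then have "1 + (m * ((m * (3 + 2) + 2) + 2) + 2) \<le> n * (n * 5 + 4) + 3" by (simp add: algebra_simps)
  ultimately show ?thesis
    by (rule runs_weaken) (use m ms in \<open>simp add: J_def matrix_state_def\<close>)
qed

section \<open>The complete program\<close>

definition kernel_time :: "nat \<Rightarrow> nat" where
  "kernel_time n = n * (n * (n * 4 + 14)) + n * 32 + 30"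

lemma runs_Kernel:
  assumes s: "s ''n'' 0 = n" "s ''k'' 0 = k" "s ''R'' 0 = 0" "s ''D'' 0 = 0" "s ''f'' 0 = 0"
    and A: "\<forall>u<n. \<forall>v<n. s ''A'' (u * n + v) = A u v"
    and M: "\<And>u v. M u v = (if u = v then 2 else A u v)" and D: "D = 35 * k * min n k"
  shows "runs Kernel (kernel_time n) s (\<lambda>s'.
    (n \<le> 4 * D \<and> s' ''n'' 0 = n \<and> s' ''k'' 0 = k \<and> s' ''A'' = s ''A'') \<or>
    (4 * D < n \<and> (\<exists>b c m L. b < n \<and> n \<le> twin_count n M b n + D \<and> even (twin_count n M b n + c) \<and>
      D \<le> c \<and> c \<le> D + 1 \<and> s' ''n'' 0 = m \<and> s' ''k'' 0 = k \<and> bij_betw L {..<m} (kept n M b c n) \<and>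
      (\<forall>i<m. \<forall>j<m. s' ''A'' (i * m + j) = (if i = j then 0 else M (L i) (L j))))) \<or>
    (4 * D < n \<and> (\<forall>c<n. \<not> n \<le> twin_count n M c n + D) \<and>
      s' ''n'' 0 = 2 \<and> s' ''k'' 0 = 1 \<and>
      (\<forall>i<2. \<forall>j<2. s' ''A'' (i * 2 + j) = (if i = j then 0 else 1))))"
    (is "runs _ _ _ (\<lambda>s'. ?small s' \<or> ?shrunk s' \<or> ?trivial s')")
proof -
  let ?Q = "\<lambda>s'. ?small s' \<or> ?shrunk s' \<or> ?trivial s'"
  let ?reduce = "Seq Reduce (Seq Keep (Seq Compact (Set_var ''n'' (var ''m''))))"
  let ?choose = "If (Less (Const 0) (var ''f'')) ?reduce Trivial"
  let ?main = "Seq Diagonal (Seq Twins ?choose)"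
  let ?T4 = "(n * 4 + 2) + ((n * 7 + 4) + ((n * (n * 5 + 4) + 3) + 1))"
  \<comment> \<open>Both branches of the conditional need a common bound; the sum of the two bounds
    serves, 6 being the cost of \<open>Trivial\<close>.\<close>
  let ?T3 = "1 + (?T4 + 6)"
  let ?T2 = "(n * 3 + 2) + ((n * (n * (4 * n + 9) + 9) + 2) + ?T3)"
  have reduce: "runs ?reduce ?T4 s3 ?Q"
    if s3: "matrix_state n k D M s3" "twins_done n M D n s3" "s3 ''f'' 0 \<noteq> 0" and large: "4 * D < n" for s3
  proof -
    define b where "b = s3 ''b'' 0"
    have b: "b < n" "s3 ''c'' 0 = twin_count n M b n" "n \<le> twin_count n M b n + D"
      and W: "\<forall>u<n. s3 ''W'' (b * n + u) = (if twin_rows n M b u then 1 else 0)"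
      using s3(2,3) by (auto simp: twins_done_def b_def)
    have "twin_count n M b n \<le> card {..<n}" by (rule card_mono) auto
    then have "twin_count n M b n \<le> n" by simp
    moreover have "D \<le> twin_count n M b n" using b(3) large by linarith
    ultimately show ?thesis
    proof (rule runs_Seq[OF runs_Reduce[OF s3(1) b(2)]], goal_cases)
      case (1 s4)
      define c where "c = s4 ''c'' 0"
      have ms4: "matrix_state n k D M s4" "s4 ''b'' 0 = b" "s4 ''W'' = s3 ''W''"
        using 1 s3(1) matrix_state_cong[of s4 s3] by (simp_all add: b_def)
      have c: "even (twin_count n M b n + c)" "D \<le> c" "c \<le> D + 1" using 1 by (simp_all add: c_def)
      show ?case
      proof (rule runs_Seq[OF runs_Keep[OF ms4(1,2) b(1) c_def[symmetric]]])
        show "\<forall>u<n. s4 ''W'' (b * n + u) = (if twin_rows n M b u then 1 else 0)"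
          using W ms4(3) by simp
        fix s5 assume 5: "matrix_state n k D M s5 \<and> s5 ''m'' 0 \<le> n \<and>
          bij_betw (s5 ''L'') {..<s5 ''m'' 0} (kept n M b c n) \<and> (\<forall>r<s5 ''m'' 0. r \<le> s5 ''L'' r)"
        define m where "m = s5 ''m'' 0"
        define L where "L = s5 ''L''"
        have L: "bij_betw L {..<m} (kept n M b c n)" "\<And>r. r < m \<Longrightarrow> r \<le> L r"
          using 5 by (simp_all add: L_def m_def)
        have "L r < n" if "r < m" for r
          using bij_betw_apply[OF L(1)] that by (auto simp: kept_def)
        then have "runs Compact (n * (n * 5 + 4) + 3) s5 (\<lambda>s'. s' ''m'' 0 = m \<and> s' ''k'' 0 = k \<and>
            (\<forall>i<m. \<forall>j<m. s' ''A'' (i * m + j) = (if i = j then 0 else M (L i) (L j))))"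
          using 5 L(2) by (intro runs_Compact[where D = D]) (simp_all add: m_def L_def)
        then show "runs (Seq Compact (Set_var ''n'' (var ''m''))) ((n * (n * 5 + 4) + 3) + 1) s5 ?Q"
        proof (rule runs_Seq)
          fix s6 assume 6: "s6 ''m'' 0 = m \<and> s6 ''k'' 0 = k \<and>
            (\<forall>i<m. \<forall>j<m. s6 ''A'' (i * m + j) = (if i = j then 0 else M (L i) (L j)))"
          have "?shrunk (set_var ''n'' m s6)"
            using 6 L(1) b c large by (intro conjI exI[of _ b] exI[of _ c] exI[of _ m] exI[of _ L]) simp_all
          then show "runs (Set_var ''n'' (var ''m'')) 1 s6 ?Q"
            using 6 by (intro runs_loop_free) simp_all
        qed
      qed
    qed
  qed
  have trivial: "runs Trivial 6 s3 ?Q"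
    if s3: "twins_done n M D n s3" "s3 ''f'' 0 = 0" and large: "4 * D < n" for s3
  proof (rule runs_loop_free)
    have "\<forall>c<n. \<not> n \<le> twin_count n M c n + D" using s3 unfolding twins_done_def by blast
    moreover have "\<forall>i<2. \<forall>j<2. run Trivial s3 ''A'' (i * 2 + j) = (if i = j then 0 else 1)"
      by (auto simp: Trivial_def less_2_cases_iff)
    moreover have "run Trivial s3 ''n'' 0 = 2" "run Trivial s3 ''k'' 0 = 1" by (simp_all add: Trivial_def)
    ultimately have "?trivial (run Trivial s3)" using large by blast
    then show "?Q (run Trivial s3)" by blast
  qed (simp_all add: Trivial_def)
  have main: "runs ?main ?T2 s1 ?Q"
    if s1: "s1 ''n'' 0 = n" "s1 ''k'' 0 = k" "s1 ''f'' 0 = 0" "s1 ''D'' 0 = D"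
      "\<forall>i\<le>n. s1 ''R'' i = i * n" "s1 ''A'' = s ''A''" and large: "4 * D < n" for s1
  proof (rule runs_Seq[OF runs_Diagonal[where s = s1, OF s1(1-5)]])
    show "\<forall>u<n. \<forall>v<n. s1 ''A'' (u * n + v) = A u v" using A s1(6) by simp
    fix s2 assume 2: "s2 ''n'' 0 = n \<and> s2 ''k'' 0 = k \<and> s2 ''f'' 0 = 0 \<and>
      s2 ''D'' 0 = D \<and> (\<forall>i\<le>n. s2 ''R'' i = i * n) \<and>
      (\<forall>u<n. \<forall>v<n. s2 ''A'' (u * n + v) = (if u = v then 2 else A u v))"
    then have ms2: "matrix_state n k D M s2" unfolding matrix_state_def M by blast
    show "runs (Seq Twins ?choose) ((n * (n * (4 * n + 9) + 9) + 2) + ?T3) s2 ?Q"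
    proof (rule runs_Seq[OF runs_Twins[OF ms2]])
      show "s2 ''f'' 0 = 0" using 2 by simp
      fix s3 assume 3: "matrix_state n k D M s3 \<and> twins_done n M D n s3"
      show "runs ?choose ?T3 s3 ?Q"
      proof (rule runs_If)
        assume "bval (Less (Const 0) (var ''f'')) s3"
        then show "runs ?reduce (?T4 + 6) s3 ?Q"
          using 3 large by (intro runs_weaken[OF reduce]) simp_all
      next
        assume "\<not> bval (Less (Const 0) (var ''f'')) s3"
        then show "runs Trivial (?T4 + 6) s3 ?Q"
          using 3 large by (intro runs_weaken[OF trivial]) simp_all
      qed
    qed
  qed
  have "runs Kernel ((n * 5 + 2) + (1 + ?T2)) s ?Q"
    unfolding Kernel_def
  proof (rule runs_Seq[OF runs_Init[where s = s, OF s]])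
    fix s1 assume 1: "s1 ''n'' 0 = n \<and> s1 ''k'' 0 = k \<and> s1 ''A'' = s ''A'' \<and>
      s1 ''f'' 0 = 0 \<and> (\<forall>i\<le>n. s1 ''R'' i = i * n) \<and> s1 ''D'' 0 = 35 * k * min n k"
    show "runs (If (Less (Times 4 (var ''D'')) (var ''n'')) ?main Skip) (1 + ?T2) s1 ?Q"
    proof (rule runs_If)
      assume "bval (Less (Times 4 (var ''D'')) (var ''n'')) s1"
      then have "4 * D < n" using 1 D by simp
      then show "runs ?main ?T2 s1 ?Q" using 1 D by (intro main) simp_all
    next
      assume "\<not> bval (Less (Times 4 (var ''D'')) (var ''n'')) s1"
      then have "?small s1" using 1 D by simp
      then show "runs Skip ?T2 s1 ?Q" by (intro runs_loop_free) simp_all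
    qed
  qed
  then show ?thesis
    by (rule runs_weaken) (simp_all add: kernel_time_def algebra_simps)
qed

section \<open>From the output of the machine back to signed graphs\<close>

lemma twin_rows_iff_twin:
  assumes M: "\<And>u v. M u v = (if u = v then 2 else adj_entry G u v)"
  shows "twin_rows n M c u \<longleftrightarrow> signed_matrix.twin (sgraph_matrix G) {..<n} c u"
proof -
  have e: "M u w = 0 \<and> sgraph_matrix G u w = 0 \<or> M u w = 1 \<and> sgraph_matrix G u w = 1 \<or>
      M u w = 2 \<and> sgraph_matrix G u w = -1" for u w
    by (simp add: M adj_entry_def sgraph_matrix_def)
  have "M u w = M c w \<longleftrightarrow> sgraph_matrix G u w = sgraph_matrix G c w"
    "M u w = opposite_entry (M c w) \<longleftrightarrow> sgraph_matrix G u w = - sgraph_matrix G c w" for w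
    using e[of u w] e[of c w] by (auto simp: opposite_entry_def)
  then show ?thesis
    by (simp add: twin_rows_def signed_matrix.twin_def[OF signed_matrix_sgraph_matrix] Ball_def)
qed

lemma kernel_time_poly:
  obtains p where "\<And>n N. n \<le> N \<Longrightarrow> kernel_time n \<le> poly p N"
proof
  fix n N :: nat assume "n \<le> N"
  then have "kernel_time n \<le> kernel_time N"
    unfolding kernel_time_def by (intro add_mono mult_mono) auto
  also have "kernel_time N = poly [:30, 32, 14, 4:] N"
    by (simp add: kernel_time_def algebra_simps)
  finally show "kernel_time n \<le> poly [:30, 32, 14, 4:] N" .
qed

theorem theorem3p6:
  shows "\<exists>(prog :: com) (p :: nat poly) (c :: nat).
    \<forall>(G :: nat sgraph) (k :: nat) (n :: nat).
      smc_instance G k \<and> split_graph G \<and> verts G = {..<n} \<longrightarrow>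
      (\<exists>t s G' k'.
         exec prog (input_state G k) t s \<and>
         t \<le> poly p (instance_size G k) \<and>
         represents s G' k' \<and>
         smc_instance G' k' \<and>
         card (verts G') \<le> c * k\<^sup>2 \<and>
         (smc_yes G k \<longleftrightarrow> smc_yes G' k'))"
proof -
  obtain p where p: "\<And>n N. n \<le> N \<Longrightarrow> kernel_time n \<le> poly p N"
    using kernel_time_poly by blast
  \<comment> \<open>The constant 140 is 4 * 35 and stems from the instances returned unchanged; the
    shrunk ones stay below 3D.\<close>
  have "\<exists>t s G' k'. exec Kernel (input_state G k) t s \<and> t \<le> poly p (instance_size G k) \<and>
      represents s G' k' \<and> smc_instance G' k' \<and> card (verts G') \<le> 140 * k\<^sup>2 \<and>
      (smc_yes G k \<longleftrightarrow> smc_yes G' k')"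
    if inst: "smc_instance G k" and split: "split_graph G" and V: "verts G = {..<n}" for G k n
  proof -
    let ?s = "input_state G k"
    define M where "M u v = (if u = v then 2 else adj_entry G u v)" for u v
    define D where "D = 35 * k * min n k"
    have k: "k > 0" using inst by (simp add: smc_instance_def)
    have D_le: "D \<le> 35 * k\<^sup>2" by (simp add: D_def power2_eq_square)
    have repr: "represents ?s G k" using V by (rule represents_input_state)
    then have s: "?s ''n'' 0 = n" "?s ''k'' 0 = k"
      using V by (simp_all add: represents_def)
    then have A: "\<forall>u<n. \<forall>v<n. ?s ''A'' (u * n + v) = adj_entry G u v"
      using repr V by (simp add: represents_def)
    have s0: "?s ''R'' 0 = 0" "?s ''D'' 0 = 0" "?s ''f'' 0 = 0" by (simp_all add: input_state_def Let_def)
    have tw: "twin_rows n M c u \<longleftrightarrow> signed_matrix.twin (sgraph_matrix G) (verts G) c u" for c u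
      unfolding V by (rule twin_rows_iff_twin) (rule M_def)
    obtain t s' where exec: "exec Kernel ?s t s'" and t: "t \<le> kernel_time n" and
      out: "(n \<le> 4 * D \<and> s' ''n'' 0 = n \<and> s' ''k'' 0 = k \<and> s' ''A'' = ?s ''A'') \<or>
        (4 * D < n \<and> (\<exists>b c m L. b < n \<and> n \<le> twin_count n M b n + D \<and> even (twin_count n M b n + c) \<and>
          D \<le> c \<and> c \<le> D + 1 \<and> s' ''n'' 0 = m \<and> s' ''k'' 0 = k \<and> bij_betw L {..<m} (kept n M b c n) \<and>
          (\<forall>i<m. \<forall>j<m. s' ''A'' (i * m + j) = (if i = j then 0 else M (L i) (L j))))) \<or>
        (4 * D < n \<and> (\<forall>c<n. \<not> n \<le> twin_count n M c n + D) \<and>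
          s' ''n'' 0 = 2 \<and> s' ''k'' 0 = 1 \<and>
          (\<forall>i<2. \<forall>j<2. s' ''A'' (i * 2 + j) = (if i = j then 0 else 1)))"
      using runs_Kernel[where s = ?s, OF s s0 A M_def D_def] unfolding runs_def by blast
    have "n \<le> instance_size G k"
      using V by (simp add: instance_size_def power2_nat_le_imp_le trans_le_add1 self_le_power)
    then have time: "t \<le> poly p (instance_size G k)" using t p order_trans by blast
    \<comment> \<open>For k \<ge> n the bound D is 35 k n, at least n, so the size test fails; in
      the large case the minimum is therefore k.\<close>
    have D_eq: "D = 35 * k\<^sup>2" if "4 * D < n"
    proof -
      have "k < n"
      proof (rule ccontr)
        assume "\<not> k < n"
        then have "D = 35 * k * n" by (simp add: D_def)
        moreover have "1 * n \<le> 35 * k * n" using k by (intro mult_right_mono) auto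
        ultimately show False using that by simp
      qed
      then show ?thesis by (simp add: D_def power2_eq_square)
    qed
    have "\<exists>G' k'. represents s' G' k' \<and> smc_instance G' k' \<and> card (verts G') \<le> 140 * k\<^sup>2 \<and>
      (smc_yes G k \<longleftrightarrow> smc_yes G' k')"
      using out
    proof (elim disjE conjE exE)
      assume small: "n \<le> 4 * D" "s' ''n'' 0 = n" "s' ''k'' 0 = k" "s' ''A'' = ?s ''A''"
      then have "represents s' G k" using repr s by (simp add: represents_def)
      then show ?thesis using inst V small D_le by (intro exI[of _ G] exI[of _ k]) simp
    next
      fix b c m L
      assume large: "4 * D < n" and b: "b < n" "n \<le> twin_count n M b n + D"
        and c: "even (twin_count n M b n + c)" "D \<le> c" "c \<le> D + 1"
        and s': "s' ''n'' 0 = m" "s' ''k'' 0 = k" and L: "bij_betw L {..<m} (kept n M b c n)"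
        and A': "\<forall>i<m. \<forall>j<m. s' ''A'' (i * m + j) = (if i = j then 0 else M (L i) (L j))"
      define H where "H = graph_of_entries m (\<lambda>i j. adj_entry G (L i) (L j))"
      define X where "X = {u \<in> verts G. signed_matrix.twin (sgraph_matrix G) (verts G) b u}"
      define X' where "X' = {u \<in> X. twin_count n M b u < c}"
      have X: "X = {u. u < n \<and> twin_rows n M b u}" by (auto simp: X_def tw V)
      then have cX: "twin_count n M b n = card X" by simp
      have "X' = {u. u < n \<and> twin_rows n M b u \<and> twin_count n M b u < c}" by (auto simp: X'_def X)
      then have cX': "card X' = c" using card_kept_twins[of n n M b c] b(2) c(3) large by simp
      have finX: "finite X" "X \<subseteq> verts G" by (auto simp: X V)
      then have cR: "card (verts G - X) \<le> D" using b(2) V cX by (simp add: card_Diff_subset)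
      have D0: "D > 0" using D_eq[OF large] k by simp
      have kept: "kept n M b c n = verts G - X \<union> X'" by (auto simp: kept_def X X'_def V)
      have H_inst: "smc_instance H k \<and> (smc_yes G k \<longleftrightarrow> smc_yes H k)"
      proof (rule shrink_twin_class_instance[OF inst _ X_def])
        show "X' \<subseteq> X" by (auto simp: X'_def)
        show "X' \<noteq> {}" using cX' c(2) D0 by auto
        show "bij_betw L {..<m} (verts G - X \<union> X')" using L kept by simp
      qed (use b V c cX cX' cR H_def in simp_all)
      have sym: "adj_entry G u v = adj_entry G v u" for u v by (simp add: adj_entry_def insert_commute)
      note goe = graph_of_entries[where n = m and M = "\<lambda>i j. adj_entry G (L i) (L j)", OF sym, folded H_def]
      have "adj_entry H i j = (if i = j then 0 else M (L i) (L j))" if "i < m" "j < m" for i j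
      proof -
        have "i \<noteq> j \<Longrightarrow> L i \<noteq> L j" using that L by (auto simp: bij_betw_def inj_on_def)
        moreover have "adj_entry G (L i) (L j) \<in> {0, 1, 2}" by (simp add: adj_entry_def)
        ultimately show ?thesis
          unfolding H_def adj_entry_graph_of_entries[where M = "\<lambda>i j. adj_entry G (L i) (L j)", OF sym that]
          by (auto simp: M_def)
      qed
      then have "represents s' H k" using s' A' by (simp add: represents_def goe(2))
      moreover have "card (verts H) \<le> 140 * k\<^sup>2"
      proof -
        \<comment> \<open>At most D vertices lie outside the class and at most D + 1 twins are kept;
          D \<ge> 1 absorbs the extra one.\<close>
        have "card (verts H) = card (kept n M b c n)" using bij_betw_same_card[OF L] by (simp add: goe(2))
        also have "\<dots> \<le> card (verts G - X) + card X'" unfolding kept by (rule card_Un_le)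
        also have "\<dots> \<le> 3 * D" using cR cX' c(3) D0 by simp
        finally show ?thesis using D_le by simp
      qed
      ultimately show ?thesis using H_inst by blast
    next
      assume large: "4 * D < n" and none: "\<forall>c<n. \<not> n \<le> twin_count n M c n + D"
        and s': "s' ''n'' 0 = 2" "s' ''k'' 0 = 1"
          "\<forall>i<2. \<forall>j<2. s' ''A'' (i * 2 + j) = (if i = j then 0 else 1)"
      let ?H = "graph_of_entries 2 (\<lambda>_ _. 1)"
      \<comment> \<open>This is where the split property enters: a large split No-instance would
        have a twin class missing at most D vertices, and the search found none.\<close>
      have "smc_yes G k"
      proof (rule ccontr)
        assume "\<not> smc_yes G k"
        moreover have "35 * k\<^sup>2 < card (verts G)" using large D_eq[OF large] V by simp
        ultimately obtain c where "c \<in> verts G" "card (verts G) \<le>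
            card {u \<in> verts G. signed_matrix.twin (sgraph_matrix G) (verts G) c u} + 35 * k\<^sup>2"
          using split_graph_large_twin_class[OF inst split] by blast
        moreover have "{u \<in> verts G. signed_matrix.twin (sgraph_matrix G) (verts G) c u} =
            {u. u < n \<and> twin_rows n M c u}"
          by (auto simp: tw V)
        ultimately show False using none D_eq[OF large] V by simp
      qed
      moreover have "represents s' ?H 1"
        using s' by (simp add: represents_def graph_of_entries(2) adj_entry_graph_of_entries)
      moreover have "card (verts ?H) \<le> 140 * k\<^sup>2"
      proof -
        have "1 \<le> k\<^sup>2" using k by simp
        then show ?thesis by (simp add: graph_of_entries)
      qed
      ultimately show ?thesis
        using trivial_yes_instance by (intro exI[of _ ?H] exI[of _ 1]) simp
    qed
    then show ?thesis using exec time by blast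
  qed
  then show ?thesis by blast
qed

end
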